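(* Let $n\ge 0$ be an integer, let $\mathcal{F}$ be an $n$-cover, and let $\leq_1$ and $\leq_2$ be two linear orders on $\mathcal{F}$. Then there is $u\in\mathbb{S}^n$ witnessing an alternating monotone pattern of length at least $\left(\frac{n+1}{2}\right)^{1/2}$ for both orders. That is, there are $u\in \mathbb{S}^n$, an integer $k\geq \left(\frac{n+1}{2}\right)^{1/2}$, and $F_1,\dots,F_k\in\mathcal{F}$ such that: (1) either $u\in(-1)^{i-1}F_i$ for all $i=1,\dots,k$, or $u\in(-1)^{i}F_i$ for all $i=1,\dots,k$; (2) either $F_1\leq_1 F_2\leq_1\dots\leq_1 F_k$ or $F_1\geq_1 F_2\geq_1\dots\geq_1 F_k$; and, similarly, either $F_1\leq_2 F_2\leq_2\dots\leq_2 F_k$ or $F_1\geq_2 F_2\geq_2\dots\geq_2 F_k$. Moreover, this is asymptotically sharp in the following sense: for every such $n$ there are an $n$-cover $\mathcal{F}$ and two linear orders $\leq_1,\leq_2$ on $\mathcal{F}$ such that, whenever $u\in\mathbb{S}^n$, $k\ge 1$ and $F_1,\dots,F_k\in\mathcal{F}$ satisfy (1) and (2), one has $k\leq\lceil\sqrt{n+2}\,\rceil$.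
   Context: $\mathbb{S}^n$ is the unit sphere in $\mathbb{R}^{n+1}$, with antipodal map $u\mapsto -u$. For $F\subseteq\mathbb{S}^n$, $-F=\{-u : u\in F\}$, $(+1)F=F$ and $(-1)F=-F$. A set $F\subseteq \mathbb{S}^n$ is antipodal-free if $F\cap(-F)=\emptyset$. An $n$-cover is a finite family $\mathcal{F}$ of closed antipodal-free subsets of $\mathbb{S}^n$ whose union is $\mathbb{S}^n$. *)

theory Defs
  imports "HOL-Analysis.Analysis"
begin

definition antipodal_free :: "'a::real_vector set \<Rightarrow> bool" where
  "antipodal_free F \<longleftrightarrow> F \<inter> uminus ` F = {}"

text \<open>
  For \<open>CARD('d) = n + 1\<close> the set \<open>sphere 0 1\<close> is the \<open>n\<close>-sphere in \<open>(n + 1)\<close>-space,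
  and the following predicate describes the \<open>n\<close>-covers.
\<close>

definition sphere_cover :: "(real ^ 'd) set set \<Rightarrow> bool" where
  "sphere_cover \<F> \<longleftrightarrow>
     finite \<F> \<and>
     (\<forall>F\<in>\<F>. F \<subseteq> sphere 0 1 \<and> closed F \<and> antipodal_free F) \<and>
     \<Union>\<F> = sphere 0 1"

text \<open>
  Sequences \<open>F\<^sub>1, \<dots>, F\<^sub>k\<close> are functions on the naturals of which only the values at
  \<open>1, \<dots>, k\<close> matter. The set \<open>s F\<close> for a sign \<open>s\<close> is the image of \<open>F\<close> under scaling by \<open>s\<close>.
\<close>

definition alternating_at :: "'a::real_vector \<Rightarrow> nat \<Rightarrow> (nat \<Rightarrow> 'a set) \<Rightarrow> bool" where
  "alternating_at u k F \<longleftrightarrow>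
     (\<forall>i\<in>{1..k}. u \<in> (\<lambda>v. (-1) ^ (i - 1) *\<^sub>R v) ` F i) \<or>
     (\<forall>i\<in>{1..k}. u \<in> (\<lambda>v. (-1) ^ i *\<^sub>R v) ` F i)"

definition monotone_seq :: "'b rel \<Rightarrow> nat \<Rightarrow> (nat \<Rightarrow> 'b) \<Rightarrow> bool" where
  "monotone_seq r k F \<longleftrightarrow>
     (\<forall>i\<in>{1..<k}. (F i, F (Suc i)) \<in> r) \<or>
     (\<forall>i\<in>{1..<k}. (F (Suc i), F i) \<in> r)"

end

theory Submission
  imports Defs "HOL-Library.Z2" "HOL-Library.Multiset" "HOL-Library.Sublist"
begin

text \<open>
  For the lower bound, suppose that all patterns have length at most \<open>K\<close>. As in the proof of the
  Erdos-Szekeres theorem, every signed set \<open>\<plusminus>F\<close> containing \<open>u\<close> is labelled by the lengths \<open>(a, d)\<close> of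
  the longest alternating patterns ending in it that are increasing for both orders, respectively
  increasing for the first and decreasing for the second. Sets of opposite sign have different
  labels, so the largest of the \<open>K\<^sup>2\<close> possible labels that occurs has a well-defined sign. It grows
  with the family of signed sets, and keeps its sign as long as it does not change. Evaluating this signed label on suitably thickened
  sets gives an antipodal labelling of the sphere by \<open>\<plusminus>1, \<dots>, \<plusminus>K\<^sup>2\<close> in which close points never have
  opposite labels, so \<open>n + 1 \<le> K\<^sup>2\<close> by Tucker's lemma.

  Tucker's lemma is proved without triangulations: a chain modulo two on fine tuples of points is
  an additive functional \<open>E\<close> on cochains. Rotating a subsphere to a pole in small steps
  fills the antipodally symmetric cycle carried by it, and Fan's alternating cochain evaluates to
  1 on each of the symmetric cycles obtained in this way, in particular on the one of top dimension.

  For the upper bound, a cover by \<open>n + 2\<close> sets is ordered like an extremal permutation for the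
  Erdos-Szekeres theorem.
\<close>

section \<open>Cochains modulo two on tuples\<close>

lemma bit_add_self: "a + a = (0::bit)" "a + (a + b) = (b::bit)"
  by (cases a; cases b; simp)+

declare add_bit_eq_xor [simp del] mult_bit_eq_and [simp del]

text \<open>The simplicial coboundary on ordered tuples, repetitions allowed: modulo two it sums
  over all deletions of one entry, and the recursion separates the deletion of the head.\<close>

fun coboundary :: "('a list \<Rightarrow> bit) \<Rightarrow> 'a list \<Rightarrow> bit" where
  "coboundary \<phi> [] = 0"
| "coboundary \<phi> (x # s) = \<phi> s + coboundary (\<lambda>t. \<phi> (x # t)) s"

lemma coboundary_add: "coboundary (\<lambda>t. \<phi> t + \<psi> t) s = coboundary \<phi> s + coboundary \<psi> s"
  by (induction s arbitrary: \<phi> \<psi>) (simp_all add: algebra_simps)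

lemma coboundary_zero: "coboundary (\<lambda>t. 0) s = 0"
  by (induction s) simp_all

lemma coboundary_map: "coboundary (\<lambda>t. \<phi> (map f t)) s = coboundary \<phi> (map f s)"
  by (induction s arbitrary: \<phi>) simp_all

lemma coboundary_cong:
  assumes "\<And>t. subseq t s \<Longrightarrow> \<phi> t = \<psi> t"
  shows "coboundary \<phi> s = coboundary \<psi> s"
  using assms
proof (induction s arbitrary: \<phi> \<psi>)
  case (Cons x s)
  then have "coboundary (\<lambda>t. \<phi> (x # t)) s = coboundary (\<lambda>t. \<psi> (x # t)) s"
    by (intro Cons.IH) simp
  moreover have "\<phi> s = \<psi> s"
    using Cons.prems[of s] by (simp add: list_emb_Cons)
  ultimately show ?case by simp
qed simp

section \<open>Prism operators and chain homotopies\<close>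

fun prism :: "('a \<Rightarrow> 'b) \<Rightarrow> ('a \<Rightarrow> 'b) \<Rightarrow> ('b list \<Rightarrow> bit) \<Rightarrow> 'a list \<Rightarrow> bit" where
  "prism f g \<phi> [] = 0"
| "prism f g \<phi> (x # s) =
     \<phi> (f x # g x # map g s) + prism f g (\<lambda>t. \<phi> (f x # t)) s"

lemma prism_add: "prism f g (\<lambda>t. \<phi> t + \<psi> t) s = prism f g \<phi> s + prism f g \<psi> s"
  by (induction s arbitrary: \<phi> \<psi>) (simp_all add: algebra_simps)

lemma prism_cong:
  assumes "\<And>t. length t = Suc (length s) \<Longrightarrow> set t \<subseteq> f ` set s \<union> g ` set s \<Longrightarrow> \<phi> t = \<psi> t"
  shows "prism f g \<phi> s = prism f g \<psi> s"
  using assms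
proof (induction s arbitrary: \<phi> \<psi>)
  case (Cons x s)
  have "prism f g (\<lambda>t. \<phi> (f x # t)) s = prism f g (\<lambda>t. \<psi> (f x # t)) s"
    by (intro Cons.IH Cons.prems) auto
  moreover have "\<phi> (f x # g x # map g s) = \<psi> (f x # g x # map g s)"
    by (intro Cons.prems) auto
  ultimately show ?case by simp
qed simp

text \<open>The prism over \<open>s\<close> consists of the tuples
  \<open>f x1, ..., f xi, g xi, ..., g xn\<close>. Deleting one of the two entries at
  \<open>xi\<close> gives a face shared with a neighbouring prism tuple, so only
  \<open>map f s\<close> and \<open>map g s\<close> survive; other deletions match the prisms over
  the faces of \<open>s\<close>.\<close>

lemma prism_homotopy:
  "prism f g (coboundary \<phi>) s + coboundary (prism f g \<phi>) s = \<phi> (map f s) + \<phi> (map g s)"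
proof (induction s arbitrary: \<phi>)
  case Nil
  show ?case by (simp add: bit_add_self)
next
  case (Cons x s)
  let ?\<psi> = "\<lambda>t. \<phi> (f x # t)"
  have "coboundary (prism f g ?\<psi>) s =
      ?\<psi> (map f s) + ?\<psi> (map g s) + prism f g (coboundary ?\<psi>) s"
    using Cons.IH[of ?\<psi>] by (metis add.commute bit_add_self(2))
  moreover have "coboundary (\<lambda>t. \<phi> (f x # g x # map g t)) s =
      coboundary (\<lambda>t. \<phi> (f x # g x # t)) (map g s)"
    by (rule coboundary_map)
  ultimately show ?case
    by (simp add: prism_add coboundary_add bit_add_self ac_simps)
qed

text \<open>Telescoping over a chain of maps: small steps from \<open>h 0\<close> to
  \<open>h N\<close> will keep all prism tuples fine.\<close>

lemma prism_homotopy_iterate: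
  "(\<Sum>i<N. prism (h i) (h (Suc i)) (coboundary \<phi>) s) +
     coboundary (\<lambda>t. \<Sum>i<N. prism (h i) (h (Suc i)) \<phi> t) s =
   \<phi> (map (h 0) s) + \<phi> (map (h N) s)"
proof (induction N)
  case 0
  show ?case by (simp add: coboundary_zero bit_add_self)
next
  case (Suc N)
  show ?case
    using arg_cong2[OF Suc.IH prism_homotopy[of "h N" "h (Suc N)" \<phi> s], of "(+)"]
    by (simp add: coboundary_add bit_add_self ac_simps)
qed

section \<open>Alternating label sequences\<close>

fun alternates :: "bool \<Rightarrow> int list \<Rightarrow> bit" where
  "alternates b [] = 1"
| "alternates b (x # s) = (if (0 < x) = b then alternates (\<not> b) s else 0)"

lemma coboundary_if: "coboundary (\<lambda>t. if P then \<phi> t else 0) s = (if P then coboundary \<phi> s else 0)"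
  by (simp add: coboundary_zero)

text \<open>An alternating sequence has exactly one alternating face starting with sign
  \<open>b\<close>, obtained by deleting an end. Any other sequence with such a face has one
  repeated sign; deleting either of the two equal neighbours gives that face, and the two deletions
  cancel.\<close>

lemma coboundary_alternates:
  "coboundary (alternates b) s = alternates b s + alternates (\<not> b) s"
proof (induction s arbitrary: b)
  case Nil
  show ?case by (simp add: bit_add_self)
next
  case (Cons x s)
  show ?case
    by (simp add: coboundary_if Cons.IH bit_add_self ac_simps)
qed

lemma alternates_uminus:
  "0 \<notin> set s \<Longrightarrow> alternates b (map uminus s) = alternates (\<not> b) s"
  by (induction s arbitrary: b) auto

lemma sorted_wrt_subseq:
  assumes "subseq t s" "sorted_wrt P s"
  shows "sorted_wrt P t"
  using assms
proof (induction rule: list_emb.induct)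
  case (list_emb_Cons2 x y xs ys)
  then show ?case
    using list_emb_set[of "(=)" xs ys] by auto
qed auto

text \<open>
  Labels are compared by absolute value first; the sign only serves to make the key injective, so
  that the sorted list is a function of the multiset of labels.
\<close>

definition label_key :: "int \<Rightarrow> int" where
  "label_key x = 2 * \<bar>x\<bar> + of_bool (0 < x)"

lemma label_key_le: "label_key x \<le> label_key y \<Longrightarrow> \<bar>x\<bar> \<le> \<bar>y\<bar>"
  by (auto simp: label_key_def of_bool_def split: if_splits)

lemma inj_label_key: "inj label_key"
  by (rule injI) (auto simp: label_key_def of_bool_def abs_if split: if_splits; presburger)

definition sorted_alternates :: "int list \<Rightarrow> bit" where
  "sorted_alternates s = alternates True (sort_key label_key s)"

lemma sort_label_key_eq:
  "mset s = mset t \<Longrightarrow> sort_key label_key s = sort_key label_key t"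
  by (intro sort_key_inj_key_eq) (auto intro: inj_on_subset[OF inj_label_key])

text \<open>If the order of entries does not affect a cochain, it does not affect its coboundary;
  this permits sorting a tuple before taking its faces.\<close>

lemma coboundary_mset:
  "coboundary (\<lambda>t. c (mset t)) s = (\<Sum>x\<in>#mset s. c (mset s - {#x#}))"
proof (induction s arbitrary: c)
  case (Cons x s)
  have "add_mset x (mset s - {#y#}) = add_mset x (mset s) - {#y#}" if "y \<in># mset s" for y
    using that by simp
  then have "(\<Sum>y\<in>#mset s. c (add_mset x (mset s - {#y#})))
      = (\<Sum>y\<in>#mset s. c (add_mset x (mset s) - {#y#}))"
    by (intro arg_cong[where f = sum_mset] image_mset_cong) simp
  then show ?case
    using Cons.IH[of "\<lambda>M. c (add_mset x M)"] by simp
qed simp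

text \<open>Faces of a sorted tuple are sorted, so the formula for \<open>alternates\<close>
  applies. Negation respects the order because, without complementary labels, equal absolute values
  mean equal labels.\<close>

lemma coboundary_sorted_alternates:
  assumes "0 \<notin> set s" "\<And>x y. x \<in> set s \<Longrightarrow> y \<in> set s \<Longrightarrow> x + y \<noteq> 0"
  shows "coboundary sorted_alternates s = sorted_alternates s + sorted_alternates (map uminus s)"
proof -
  define s' where "s' = sort_key label_key s"
  define c where "c M = sorted_alternates (SOME t. mset t = M)" for M
  have c: "sorted_alternates t = c (mset t)" for t
  proof -
    have "mset (SOME t'. mset t' = mset t) = mset t"
      by (rule someI) simp
    then show ?thesis
      unfolding c_def sorted_alternates_def
      by (intro arg_cong[where f = "alternates True"] sort_label_key_eq) simp
  qed
  have s': "mset s' = mset s" "set s' = set s" "sorted (map label_key s')"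
    by (simp_all add: s'_def)
  have neg: "sort_key label_key (map uminus s) = map uminus s'"
  proof (rule sort_key_inj_key_eq)
    have "label_key (- x) \<le> label_key (- y)"
      if "x \<in> set s" "y \<in> set s" "label_key x \<le> label_key y" for x y
      using label_key_le[OF that(3)] assms(2)[OF that(1,2)]
      by (cases "x = y") (auto simp: label_key_def of_bool_def abs_if split: if_splits)
    then have "sorted_wrt (\<lambda>x y. label_key (- x) \<le> label_key (- y)) s'"
      using s'(3) unfolding sorted_map s'(2)[symmetric]
      by (rule sorted_wrt_mono_rel)
    then show "sorted (map label_key (map uminus s'))"
      by (simp add: sorted_map sorted_wrt_map)
  qed (use s'(1) in \<open>auto intro: inj_on_subset[OF inj_label_key]\<close>)
  have "coboundary sorted_alternates s = coboundary (\<lambda>t. c (mset t)) s"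
    by (rule coboundary_cong) (rule c)
  also have "\<dots> = coboundary (\<lambda>t. c (mset t)) s'"
    by (simp add: coboundary_mset s'(1))
  also have "\<dots> = coboundary (alternates True) s'"
  proof (rule coboundary_cong)
    fix t assume "subseq t s'"
    then have "sorted (map label_key t)"
      using s'(3) unfolding sorted_map by (rule sorted_wrt_subseq)
    then have "sort_key label_key t = t"
      by (intro sort_key_inj_key_eq inj_on_subset[OF inj_label_key]) auto
    then show "c (mset t) = alternates True t"
      using c[of t] by (simp add: sorted_alternates_def)
  qed
  also have "\<dots> = alternates True s' + alternates True (map uminus s')"
    using assms(1) s'(2) by (simp add: coboundary_alternates alternates_uminus)
  finally show ?thesis
    by (simp add: sorted_alternates_def neg s'_def)
qed

text \<open>Neighbours in the sorted sequence differ in sign and are not complementary, so their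
  absolute values strictly increase within \<open>{1..m}\<close>.\<close>

lemma alternates_length:
  assumes "sorted (map label_key s)" "alternates b s = 1" "0 \<notin> set s"
    "\<And>x y. x \<in> set s \<Longrightarrow> y \<in> set s \<Longrightarrow> x + y \<noteq> 0" "\<forall>x\<in>set s. \<bar>x\<bar> \<le> m" "0 \<le> m"
  shows "int (length s) \<le> m"
proof -
  have "sorted_wrt (<) (map abs s)"
    using assms(1-4)
  proof (induction s arbitrary: b)
    case (Cons x s)
    then have IH: "sorted_wrt (<) (map abs s)"
      by (auto split: if_splits)
    show ?case
    proof (cases s)
      case Nil
      then show ?thesis by simp
    next
      case (Cons y t)
      have "\<bar>x\<bar> \<le> \<bar>y\<bar>" "(0 < x) \<noteq> (0 < y)" "x + y \<noteq> 0"
        using Cons.prems Cons label_key_le by (auto split: if_splits)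
      then have "\<bar>x\<bar> < \<bar>y\<bar>" by auto
      then show ?thesis
        using IH Cons by auto
    qed
  qed simp
  then have "distinct (map abs s)"
    using strict_sorted_iff by blast
  then have "length s = card (abs ` set s)"
    using distinct_card by fastforce
  also have "\<dots> \<le> card {1..m}"
  proof (intro card_mono subsetI)
    fix y assume "y \<in> abs ` set s"
    then show "y \<in> {1..m}"
      using assms(3,5) by (cases "y = 0") auto
  qed simp
  finally show ?thesis
    using assms(6) by simp
qed

section \<open>Antipodally symmetric fine chains on spheres\<close>

definition rotate_to :: "'a::real_inner \<Rightarrow> real \<Rightarrow> 'a \<Rightarrow> 'a" where
  "rotate_to p t x = cos t *\<^sub>R x + sin t *\<^sub>R p"

lemma norm_rotate_to:
  assumes "norm x = 1" "norm p = 1" "x \<bullet> p = 0"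
  shows "norm (rotate_to p t x) = 1"
proof -
  have "(norm (rotate_to p t x))\<^sup>2 = (norm (cos t *\<^sub>R x))\<^sup>2 + (norm (sin t *\<^sub>R p))\<^sup>2"
    unfolding rotate_to_def
    by (rule norm_add_Pythagorean) (simp add: assms orthogonal_def)
  also have "\<dots> = 1"
    by (simp add: assms)
  finally show ?thesis
    using power2_eq_imp_eq[of "norm (rotate_to p t x)" 1] by simp
qed

lemma abs_cos_diff_le: "\<bar>cos s - cos t\<bar> \<le> \<bar>s - t\<bar>" for s t :: real
proof -
  have "\<bar>cos s - cos t\<bar> = 2 * \<bar>sin ((s + t) / 2)\<bar> * \<bar>sin ((t - s) / 2)\<bar>"
    by (simp add: cos_diff_cos abs_mult)
  also have "\<dots> \<le> 2 * 1 * \<bar>(t - s) / 2\<bar>"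
    by (intro mult_mono abs_sin_x_le_abs_x) auto
  finally show ?thesis by simp
qed

lemma abs_sin_diff_le: "\<bar>sin s - sin t\<bar> \<le> \<bar>s - t\<bar>" for s t :: real
  using abs_cos_diff_le[of "pi / 2 - s" "pi / 2 - t"] by (simp add: sin_cos_eq)

lemma dist_rotate_to:
  assumes "norm y = 1" "norm p = 1"
  shows "dist (rotate_to p s x) (rotate_to p t y) \<le> dist x y + 2 * \<bar>s - t\<bar>"
proof -
  have "rotate_to p s x - rotate_to p t y =
      cos s *\<^sub>R (x - y) + (cos s - cos t) *\<^sub>R y + (sin s - sin t) *\<^sub>R p"
    by (simp add: rotate_to_def algebra_simps)
  then have "dist (rotate_to p s x) (rotate_to p t y) \<le>
      norm (cos s *\<^sub>R (x - y)) + norm ((cos s - cos t) *\<^sub>R y) + norm ((sin s - sin t) *\<^sub>R p)"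
    unfolding dist_norm by (metis norm_triangle_ineq norm_triangle_le add_mono order_refl)
  also have "\<dots> \<le> 1 * norm (x - y) + \<bar>s - t\<bar> + \<bar>s - t\<bar>"
    using assms abs_cos_diff_le[of s t] abs_sin_diff_le[of s t]
    by (intro add_mono) (auto intro!: mult_left_le_one_le)
  finally show ?thesis
    by (simp add: dist_norm)
qed

text \<open>\<open>L\<close> is both the number of entries and, for an enumerated basis
  \<open>b\<close>, the dimension of the subspace spanned by \<open>b 0, ..., b (L - 1)\<close>:
  these are small simplices of the same dimension as the sphere carrying them.\<close>

definition fine_tuples :: "(nat \<Rightarrow> 'a::euclidean_space) \<Rightarrow> nat \<Rightarrow> real \<Rightarrow> 'a list set" where
  "fine_tuples b L \<delta> = {s. length s = L \<and>
     (\<forall>x\<in>set s. norm x = 1 \<and> (\<forall>j\<in>{L..<DIM('a)}. x \<bullet> b j = 0)) \<and>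
     (\<forall>x\<in>set s. \<forall>y\<in>set s. dist x y \<le> \<delta>)}"

lemma fine_tuples_uminus: "s \<in> fine_tuples b L \<delta> \<Longrightarrow> map uminus s \<in> fine_tuples b L \<delta>"
  by (simp add: fine_tuples_def dist_minus)

text \<open>
  The last condition says that \<open>c + \<nu> c\<close> is a cycle, where \<open>c\<close> is the chain with \<open>E \<phi> = \<phi>(c)\<close> and
  \<open>\<nu>\<close> the antipodal map.
\<close>

definition symmetric_chain ::
    "(nat \<Rightarrow> 'a::euclidean_space) \<Rightarrow> nat \<Rightarrow> real \<Rightarrow> (('a list \<Rightarrow> bit) \<Rightarrow> bit) \<Rightarrow> bool" where
  "symmetric_chain b L \<delta> E \<longleftrightarrow>
     (\<forall>\<phi> \<psi>. E (\<lambda>s. \<phi> s + \<psi> s) = E \<phi> + E \<psi>) \<and>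
     (\<forall>\<phi> \<psi>. (\<forall>s\<in>fine_tuples b L \<delta>. \<phi> s = \<psi> s) \<longrightarrow> E \<phi> = E \<psi>) \<and>
     (\<forall>\<phi>. E (\<lambda>s. coboundary \<phi> s + coboundary \<phi> (map uminus s)) = 0)"

lemma symmetric_chain_add:
  "symmetric_chain b L \<delta> E \<Longrightarrow> E (\<lambda>s. \<phi> s + \<psi> s) = E \<phi> + E \<psi>"
  by (simp add: symmetric_chain_def)

lemma symmetric_chain_cong:
  "symmetric_chain b L \<delta> E \<Longrightarrow> (\<And>s. s \<in> fine_tuples b L \<delta> \<Longrightarrow> \<phi> s = \<psi> s) \<Longrightarrow> E \<phi> = E \<psi>"
  by (simp add: symmetric_chain_def)

lemma symmetric_chain_cycle:
  "symmetric_chain b L \<delta> E \<Longrightarrow> E (\<lambda>s. coboundary \<phi> s + coboundary \<phi> (map uminus s)) = 0"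
  unfolding symmetric_chain_def by (elim conjE) (erule spec)

text \<open>The cycle \<open>c + \<nu> c\<close> is contracted to the pole \<open>b L\<close>, and
  the prism tuples swept out form the new chain \<open>c'\<close>. Its boundary is
  \<open>c + \<nu> c\<close>, which is what the equation for \<open>E'\<close> says, so
  \<open>c' + \<nu> c'\<close> is again a cycle.\<close>

lemma symmetric_chain_step:
  fixes b :: "nat \<Rightarrow> 'a::euclidean_space"
  assumes b: "bij_betw b {..<DIM('a)} Basis" and L: "L < DIM('a)" and "0 < \<delta>"
    and E: "symmetric_chain b L (\<delta> / 2) E"
  obtains E' where "symmetric_chain b (Suc L) \<delta> E'"
    and "\<And>\<phi>. E' (coboundary \<phi>) = E (\<lambda>s. \<phi> s + \<phi> (map uminus s))"
proof -
  define p where "p = b L"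
  have b_Basis: "b j \<in> Basis" if "j < DIM('a)" for j
    using b that by (auto simp: bij_betw_def)
  then have p: "norm p = 1"
    using L by (simp add: p_def)
  have p_orth: "p \<bullet> b j = 0" if "j \<in> {Suc L..<DIM('a)}" for j
    using that L b_Basis[of j] b_Basis[of L] bij_betw_imp_inj_on[OF b]
    by (auto simp: p_def inner_not_same_Basis inj_on_eq_iff)
  obtain N :: nat where "4 * pi / \<delta> < real N"
    using reals_Archimedean2 by blast
  with \<open>0 < \<delta>\<close> have "4 * pi < real N * \<delta>"
    by (simp add: pos_divide_less_eq)
  moreover from this have "0 < N"
    using pi_gt_zero by (cases N) auto
  ultimately have N: "0 < N" "pi / real N \<le> \<delta> / 4"
    by (simp_all add: pos_divide_le_eq mult.commute)
  define t where "t i = real i * (pi / 2 / real N)" for i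
  define h where "h i = rotate_to p (t i)" for i
  have h0: "h 0 = id" and hN: "h N = (\<lambda>x. p)"
    using N by (auto simp: h_def t_def rotate_to_def)
  \<comment> \<open>By \<open>dist_rotate_to\<close>, a mesh of \<open>\<delta> / 2\<close> grows by
    at most \<open>2 * (\<delta> / 4)\<close> within one step, which gives exactly
    \<open>\<delta>\<close>.\<close>
  have t_step: "\<bar>t i - t j\<bar> \<le> \<delta> / 4" if "i \<in> {k, Suc k}" "j \<in> {k, Suc k}" for i j k
  proof -
    have "\<bar>t i - t j\<bar> = \<bar>real i - real j\<bar> * (pi / real N / 2)"
      unfolding t_def left_diff_distrib[symmetric] by (simp add: abs_mult)
    also have "\<dots> \<le> 1 * (pi / real N / 2)"
      using that by (intro mult_right_mono) auto
    also have "\<dots> = pi / real N / 2"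
      by (rule mult_1)
    also have "\<dots> \<le> \<delta> / 4 / 2"
      using N(2) by (rule divide_right_mono) simp
    also have "\<dots> \<le> \<delta> / 4"
      using \<open>0 < \<delta>\<close> by simp
    finally show ?thesis .
  qed
  \<comment> \<open>\<open>T\<close> is the chain homotopy from the identity to the constant map
    \<open>p\<close>.\<close>
  define T where "T \<phi> s = (\<Sum>i<N. prism (h i) (h (Suc i)) \<phi> s)" for \<phi> :: "'a list \<Rightarrow> bit" and s
  have T_coboundary:
    "T (coboundary \<phi>) s = coboundary (T \<phi>) s + (\<phi> s + \<phi> (map (\<lambda>x. p) s))" for \<phi> s
  proof -
    have "T (coboundary \<phi>) s + coboundary (T \<phi>) s = \<phi> s + \<phi> (map (\<lambda>x. p) s)"
      using prism_homotopy_iterate[of h \<phi> s N] by (simp add: T_def[abs_def] h0 hN)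
    then show ?thesis
      by (metis add.commute bit_add_self(2))
  qed
  have T_add: "T (\<lambda>s. \<phi> s + \<psi> s) s = T \<phi> s + T \<psi> s" for \<phi> \<psi> s
    by (simp add: T_def prism_add sum.distrib)
  have T_cong: "T \<phi> s = T \<psi> s"
    if eq: "\<forall>s\<in>fine_tuples b (Suc L) \<delta>. \<phi> s = \<psi> s" and s: "s \<in> fine_tuples b L (\<delta> / 2)" for \<phi> \<psi> s
    unfolding T_def
  proof (intro sum.cong prism_cong refl)
    fix k u
    assume u: "length u = Suc (length s)" "set u \<subseteq> h k ` set s \<union> h (Suc k) ` set s"
    have u_cases: "\<exists>i\<in>{k, Suc k}. \<exists>z\<in>set s. x = rotate_to p (t i) z" if "x \<in> set u" for x
      using that u(2) by (auto simp: h_def)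
    have "norm x = 1 \<and> (\<forall>j\<in>{Suc L..<DIM('a)}. x \<bullet> b j = 0)" if x: "x \<in> set u" for x
    proof -
      obtain i z where z: "z \<in> set s" "x = rotate_to p (t i) z"
        using u_cases[OF x] by blast
      then have "norm z = 1" "\<forall>j\<in>{L..<DIM('a)}. z \<bullet> b j = 0"
        using s by (auto simp: fine_tuples_def)
      then show ?thesis
        using z(2) p L p_orth norm_rotate_to[of z p "t i"]
        by (auto simp: rotate_to_def inner_add_left p_def)
    qed
    moreover have "dist x y \<le> \<delta>" if x: "x \<in> set u" and y: "y \<in> set u" for x y
    proof -
      obtain i z where z: "i \<in> {k, Suc k}" "z \<in> set s" "x = rotate_to p (t i) z"
        using u_cases[OF x] by blast
      obtain j w where w: "j \<in> {k, Suc k}" "w \<in> set s" "y = rotate_to p (t j) w"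
        using u_cases[OF y] by blast
      have "dist z w \<le> \<delta> / 2" "norm w = 1"
        using s z(2) w(2) by (auto simp: fine_tuples_def)
      then show ?thesis
        using dist_rotate_to[of w p "t i" z "t j"] t_step[OF z(1) w(1)] p z(3) w(3) by simp
    qed
    ultimately have "u \<in> fine_tuples b (Suc L) \<delta>"
      using s u(1) by (simp add: fine_tuples_def)
    then show "\<phi> u = \<psi> u"
      using eq by simp
  qed
  note E_add = symmetric_chain_add[OF E] and E_cong = symmetric_chain_cong[OF E]
    and E_cycle = symmetric_chain_cycle[OF E]
  define E' where "E' \<phi> = E (\<lambda>s. T \<phi> s + T \<phi> (map uminus s))" for \<phi>
  have E'_coboundary: "E' (coboundary \<phi>) = E (\<lambda>s. \<phi> s + \<phi> (map uminus s))" for \<phi>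
  proof -
    \<comment> \<open>The constant tuples at \<open>p\<close> arising from \<open>s\<close> and from
      its antipode coincide and cancel; the coboundaries of \<open>T \<phi>\<close> contribute
      nothing because \<open>c + \<nu> c\<close> is a cycle.\<close>
    have "E' (coboundary \<phi>) =
        E (\<lambda>s. (coboundary (T \<phi>) s + coboundary (T \<phi>) (map uminus s)) + (\<phi> s + \<phi> (map uminus s)))"
      unfolding E'_def T_coboundary by (rule E_cong) (simp add: bit_add_self ac_simps comp_def)
    also have "\<dots> = E (\<lambda>s. \<phi> s + \<phi> (map uminus s))"
      by (simp only: E_add[of "\<lambda>s. coboundary (T \<phi>) s + coboundary (T \<phi>) (map uminus s)"] E_cycle add_0)
    finally show ?thesis .
  qed
  have "symmetric_chain b (Suc L) \<delta> E'"
    unfolding symmetric_chain_def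
  proof (intro conjI allI impI)
    fix \<phi> \<psi>
    have "E' (\<lambda>s. \<phi> s + \<psi> s) =
        E (\<lambda>s. (T \<phi> s + T \<phi> (map uminus s)) + (T \<psi> s + T \<psi> (map uminus s)))"
      unfolding E'_def by (rule E_cong) (simp add: T_add ac_simps)
    then show "E' (\<lambda>s. \<phi> s + \<psi> s) = E' \<phi> + E' \<psi>"
      by (simp add: E'_def E_add[of "\<lambda>s. T \<phi> s + T \<phi> (map uminus s)"])
  next
    fix \<phi> \<psi> :: "'a list \<Rightarrow> bit"
    assume eq: "\<forall>s\<in>fine_tuples b (Suc L) \<delta>. \<phi> s = \<psi> s"
    show "E' \<phi> = E' \<psi>"
      unfolding E'_def
    proof (rule E_cong)
      fix s assume s: "s \<in> fine_tuples b L (\<delta> / 2)"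
      show "T \<phi> s + T \<phi> (map uminus s) = T \<psi> s + T \<psi> (map uminus s)"
        using T_cong[OF eq s] T_cong[OF eq fine_tuples_uminus[OF s]] by simp
    qed
  next
    fix \<phi> :: "'a list \<Rightarrow> bit"
    \<comment> \<open>The antipodal map commutes with the coboundary, and symmetrizing twice gives
      zero modulo two.\<close>
    have "(\<lambda>s. coboundary \<phi> s + coboundary \<phi> (map uminus s)) = coboundary (\<lambda>s. \<phi> s + \<phi> (map uminus s))"
      by (simp add: fun_eq_iff coboundary_add coboundary_map)
    then have "E' (\<lambda>s. coboundary \<phi> s + coboundary \<phi> (map uminus s)) =
        E (\<lambda>s. (\<phi> s + \<phi> (map uminus s)) + (\<phi> (map uminus s) + \<phi> (map uminus (map uminus s))))"
      by (simp only: E'_coboundary)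
    also have "\<dots> = E (\<lambda>s. \<phi> s + \<phi> s)"
      by (intro E_cong) (simp add: bit_add_self comp_def ac_simps)
    also have "\<dots> = 0"
      by (rule trans[OF E_add bit_add_self(1)])
    finally show "E' (\<lambda>s. coboundary \<phi> s + coboundary \<phi> (map uminus s)) = 0" .
  qed
  then show thesis
    using E'_coboundary by (rule that)
qed

text \<open>For such a \<open>\<kappa>\<close> the symmetrized value under the new chain is its
  value on the coboundary, hence the symmetrized value one dimension lower. The 1 at the pair
  \<open>b 0\<close>, \<open>- b 0\<close> is thus carried up to every dimension, with the mesh
  halved at each descent.\<close>

lemma exists_symmetric_chain:
  fixes b :: "nat \<Rightarrow> 'a::euclidean_space" and \<kappa> :: "'a list \<Rightarrow> bit"
  assumes b: "bij_betw b {..<DIM('a)} Basis"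
    and base: "\<kappa> [b 0] + \<kappa> [uminus (b 0)] = 1"
    and \<kappa>: "\<And>L s. s \<in> fine_tuples b L \<epsilon> \<Longrightarrow> coboundary \<kappa> s = \<kappa> s + \<kappa> (map uminus s)"
    and "1 \<le> L" "L \<le> DIM('a)" "0 < \<delta>" "\<delta> \<le> \<epsilon>"
  shows "\<exists>E. symmetric_chain b L \<delta> E \<and> E (\<lambda>s. \<kappa> s + \<kappa> (map uminus s)) = 1"
  using assms(4-)
proof (induction L arbitrary: \<delta> rule: nat_induct_at_least)
  case base
  have b_Basis: "b j \<in> Basis" if "j < DIM('a)" for j
    using b that by (auto simp: bij_betw_def)
  have "b 0 \<bullet> b j = 0" if "j \<in> {1..<DIM('a)}" for j
    using that b_Basis[of j] b_Basis[of 0] bij_betw_imp_inj_on[OF b]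
    by (auto simp: inner_not_same_Basis inj_on_eq_iff)
  \<comment> \<open>The first chain is the point \<open>b 0\<close>: on one-entry tuples the
    coboundary is \<open>\<phi> []\<close>, and the two antipodal copies cancel.\<close>
  then have "[b 0] \<in> fine_tuples b 1 \<delta>"
    using b_Basis[of 0] base.prems by (simp add: fine_tuples_def)
  then have "symmetric_chain b 1 \<delta> (\<lambda>\<phi>. \<phi> [b 0])"
    by (auto simp: symmetric_chain_def bit_add_self)
  then show ?case
    using assms(2) by auto
next
  case (Suc L)
  obtain E where E: "symmetric_chain b L (\<delta> / 2) E" "E (\<lambda>s. \<kappa> s + \<kappa> (map uminus s)) = 1"
    using Suc.IH[of "\<delta> / 2"] Suc.prems by auto
  obtain E' where E': "symmetric_chain b (Suc L) \<delta> E'"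
    and E'_coboundary: "\<And>\<phi>. E' (coboundary \<phi>) = E (\<lambda>s. \<phi> s + \<phi> (map uminus s))"
    using symmetric_chain_step[OF b _ _ E(1)] Suc.prems by auto
  have "s \<in> fine_tuples b (Suc L) \<epsilon>" if "s \<in> fine_tuples b (Suc L) \<delta>" for s
    using that Suc.prems(3) by (force simp: fine_tuples_def)
  then have "E' (coboundary \<kappa>) = E' (\<lambda>s. \<kappa> s + \<kappa> (map uminus s))"
    by (intro symmetric_chain_cong[OF E'] \<kappa>)
  then have "E' (\<lambda>s. \<kappa> s + \<kappa> (map uminus s)) = 1"
    using E(2) E'_coboundary[of \<kappa>] by (simp only:)
  with E' show ?case by (intro exI conjI)
qed

text \<open>The cochain \<open>\<kappa>\<close> detects tuples whose sorted labels alternate. It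
  does not vanish on the top-dimensional symmetric cycle, so some fine tuple of
  \<open>DIM('a)\<close> points has alternating labels, and these have distinct absolute
  values.\<close>

theorem tucker_labelling:
  fixes lab :: "'a::euclidean_space \<Rightarrow> int" and m :: nat
  assumes odd: "\<And>x. norm x = 1 \<Longrightarrow> lab (- x) = - lab x"
    and range: "\<And>x. norm x = 1 \<Longrightarrow> lab x \<noteq> 0 \<and> \<bar>lab x\<bar> \<le> int m"
    and "0 < \<delta>"
    and compat: "\<And>x y. norm x = 1 \<Longrightarrow> norm y = 1 \<Longrightarrow> dist x y \<le> \<delta> \<Longrightarrow> lab x + lab y \<noteq> 0"
  shows "DIM('a) \<le> m"
proof -
  obtain b :: "nat \<Rightarrow> 'a" where b: "bij_betw b {..<DIM('a)} Basis"
    using ex_bij_betw_nat_finite[OF finite_Basis] by (metis lessThan_atLeast0)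
  define \<kappa> where "\<kappa> s = sorted_alternates (map lab s)" for s
  have neg: "map lab (map uminus s) = map uminus (map lab s)" if "s \<in> fine_tuples b L \<delta>" for s L
    using that odd by (auto simp: fine_tuples_def)
  have nonzero: "0 \<notin> set (map lab s)" if "s \<in> fine_tuples b L \<delta>" for s L
    using that range by (fastforce simp: fine_tuples_def)
  have no_complement: "x + y \<noteq> 0"
    if "s \<in> fine_tuples b L \<delta>" "x \<in> set (map lab s)" "y \<in> set (map lab s)" for s L x y
    using that compat by (auto simp: fine_tuples_def)
  have "coboundary \<kappa> s = \<kappa> s + \<kappa> (map uminus s)" if s: "s \<in> fine_tuples b L \<delta>" for s L
    using coboundary_sorted_alternates[OF nonzero[OF s] no_complement[OF s]]
    unfolding \<kappa>_def coboundary_map neg[OF s] by simp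
  moreover have "\<kappa> [b 0] + \<kappa> [uminus (b 0)] = 1"
  proof -
    have "norm (b 0) = 1"
      using bij_betwE[OF b] DIM_positive by (intro norm_Basis) blast
    then show ?thesis
      using odd range by (auto simp: \<kappa>_def sorted_alternates_def)
  qed
  ultimately obtain E where E: "symmetric_chain b DIM('a) \<delta> E" "E (\<lambda>s. \<kappa> s + \<kappa> (map uminus s)) = 1"
    using exists_symmetric_chain[OF b, of \<kappa> \<delta> "DIM('a)" \<delta>] \<open>0 < \<delta>\<close> by (auto simp: Suc_leI)
  have "E (\<lambda>s. 0) = 0"
    using symmetric_chain_add[OF E(1), of "\<lambda>s. 0" "\<lambda>s. 0"] by (simp add: bit_add_self)
  then obtain s where s: "s \<in> fine_tuples b DIM('a) \<delta>" "\<kappa> s + \<kappa> (map uminus s) \<noteq> 0"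
    using symmetric_chain_cong[OF E(1), of "\<lambda>s. \<kappa> s + \<kappa> (map uminus s)" "\<lambda>s. 0"] E(2)
    by fastforce
  obtain s where s: "s \<in> fine_tuples b DIM('a) \<delta>" "\<kappa> s = 1"
  proof (cases "\<kappa> s = 0")
    case True
    then show thesis
      using s that[of "map uminus s"] fine_tuples_uminus[OF s(1)] by simp
  qed (use s that in auto)
  define ls where "ls = sort_key label_key (map lab s)"
  have ls: "set ls = set (map lab s)" "length ls = DIM('a)"
    using s(1) by (simp_all add: ls_def fine_tuples_def)
  have "int (length ls) \<le> int m"
  proof (rule alternates_length[where b = True])
    show "\<forall>x\<in>set ls. \<bar>x\<bar> \<le> int m"
      unfolding ls(1) using s(1) range by (auto simp: fine_tuples_def)
    show "alternates True ls = 1"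
      using s(2) by (simp add: \<kappa>_def sorted_alternates_def ls_def)
    show "x + y \<noteq> 0" if "x \<in> set ls" "y \<in> set ls" for x y
      using that no_complement[OF s(1)] unfolding ls(1) by blast
  qed (use nonzero[OF s(1)] ls(1) in \<open>auto simp: ls_def\<close>)
  then show ?thesis
    using ls(2) by simp
qed

section \<open>Labels of signed subfamilies\<close>

text \<open>\<open>A\<close> and \<open>B\<close> stand for sets containing \<open>u\<close> and
  sets containing \<open>- u\<close>; the flag is the sign of the last set, so that a pattern can be
  prolonged at its end.\<close>

inductive pattern :: "'b set \<Rightarrow> 'b set \<Rightarrow> 'b rel \<Rightarrow> bool \<Rightarrow> nat \<Rightarrow> 'b \<Rightarrow> bool" for A B R where
  single: "F \<in> (if s then A else B) \<Longrightarrow> pattern A B R s 1 F"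
| extend: "pattern A B R (\<not> s) k G \<Longrightarrow> F \<in> (if s then A else B) \<Longrightarrow> (G, F) \<in> R \<Longrightarrow>
    pattern A B R s (Suc k) F"

lemma pattern_mono:
  assumes "pattern A B R s k F" "A \<subseteq> A'" "B \<subseteq> B'"
  shows "pattern A' B' R s k F"
  using assms(1)
proof induction
  case (single F s)
  then show ?case
    using assms(2,3) by (intro pattern.single) (auto split: if_splits)
next
  case (extend s k G F)
  then show ?case
    using assms(2,3) by (intro pattern.extend[where G = G]) (auto split: if_splits)
qed

lemma pattern_swap: "pattern A B R s k F \<longleftrightarrow> pattern B A R (\<not> s) k F"
proof -
  have "pattern B A R (\<not> s) k F" if "pattern A B R s k F" for A B s k F
    using that
  proof induction
    case (single F s)
    then show ?case
      by (intro pattern.single) (auto split: if_splits)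
  next
    case (extend s k G F)
    then show ?case
      by (intro pattern.extend[where G = G]) (auto split: if_splits)
  qed
  from this[of A B s k F] this[of B A "\<not> s" k F] show ?thesis by auto
qed

lemma pattern_sequence:
  assumes "pattern A B R s k F"
  shows "1 \<le> k \<and> (\<exists>f. f k = F \<and> (\<forall>i\<in>{1..k}. f i \<in> (if s = even (k - i) then A else B)) \<and>
    (\<forall>i\<in>{1..<k}. (f i, f (Suc i)) \<in> R))"
  using assms
proof induction
  case (single F s)
  then show ?case
    by (auto intro!: exI[of _ "\<lambda>_. F"])
next
  case (extend s k G F)
  then obtain f where f: "f k = G" "1 \<le> k" "\<forall>i\<in>{1..k}. f i \<in> (if (\<not> s) = even (k - i) then A else B)"
    "\<forall>i\<in>{1..<k}. (f i, f (Suc i)) \<in> R"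
    by auto
  have "(f(Suc k := F)) i \<in> (if s = even (Suc k - i) then A else B)" if "i \<in> {1..Suc k}" for i
  proof (cases "i = Suc k")
    case False
    then have "i \<in> {1..k}" "Suc k - i = Suc (k - i)"
      using that by auto
    then have "f i \<in> (if (\<not> s) = even (k - i) then A else B)"
      "((\<not> s) = even (k - i)) = (s = even (Suc k - i))"
      using f(3) by (blast, simp only: even_Suc, blast)
    then show ?thesis
      using False by (simp only: fun_upd_apply if_False)
  qed (use extend.hyps in auto)
  moreover have "((f(Suc k := F)) i, (f(Suc k := F)) (Suc i)) \<in> R" if "i \<in> {1..<Suc k}" for i
    using that f extend.hyps by (cases "i = k") auto
  ultimately show ?case
    by (intro conjI exI[of _ "f(Suc k := F)"]) auto
qed

section \<open>Longest patterns and the Erdos-Szekeres labels\<close>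

definition longest :: "'b set \<Rightarrow> 'b set \<Rightarrow> 'b rel \<Rightarrow> bool \<Rightarrow> 'b \<Rightarrow> nat" where
  "longest A B R s F = (GREATEST k. pattern A B R s k F)"

lemma
  assumes bound: "\<forall>s k F. pattern A B R s k F \<longrightarrow> k \<le> K" and F: "F \<in> (if s then A else B)"
  shows pattern_longest: "pattern A B R s (longest A B R s F) F"
    and longest_ge: "\<And>k. pattern A B R s k F \<Longrightarrow> k \<le> longest A B R s F"
    and longest_range: "longest A B R s F \<in> {1..K}"
proof -
  show P: "pattern A B R s (longest A B R s F) F"
    unfolding longest_def using pattern.single[OF F] by (rule GreatestI_nat) (use bound in auto)
  show "k \<le> longest A B R s F" if "pattern A B R s k F" for k
    unfolding longest_def using that by (rule Greatest_le_nat) (use bound in auto)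
  show "longest A B R s F \<in> {1..K}"
    using pattern_sequence[OF P] bound P by auto
qed

text \<open>\<open>F\<close> prolongs a longest pattern ending in \<open>G\<close>, since its sign
  is opposite.\<close>

lemma longest_less:
  assumes bound: "\<forall>s k F. pattern A B R s k F \<longrightarrow> k \<le> K"
    and "G \<in> (if s then B else A)" "F \<in> (if s then A else B)" "(G, F) \<in> R"
  shows "longest A B R (\<not> s) G < longest A B R s F"
proof -
  have "pattern A B R (\<not> s) (longest A B R (\<not> s) G) G"
    using assms(2) by (intro pattern_longest[OF bound]) auto
  then have "pattern A B R s (Suc (longest A B R (\<not> s) G)) F"
    using assms(3,4) by (rule pattern.extend)
  then show ?thesis
    using longest_ge[OF bound assms(3)] by fastforce
qed

text \<open>For lengths in \<open>{1..K}\<close> this encodes the pair lexicographically in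
  \<open>{1..K\<^sup>2}\<close>, hence the shift by 1 in the first length only.\<close>

definition rank_code :: "nat \<Rightarrow> 'b rel \<Rightarrow> 'b rel \<Rightarrow> 'b set \<Rightarrow> 'b set \<Rightarrow> bool \<Rightarrow> 'b \<Rightarrow> nat" where
  "rank_code K r1 r2 A B s F =
     (longest A B (r1 \<inter> r2) s F - 1) * K + longest A B (r1 \<inter> r2\<inverse>) s F"

definition max_rank :: "nat \<Rightarrow> 'b rel \<Rightarrow> 'b rel \<Rightarrow> 'b set \<Rightarrow> 'b set \<Rightarrow> nat" where
  "max_rank K r1 r2 A B = Max (rank_code K r1 r2 A B True ` A \<union> rank_code K r1 r2 A B False ` B)"

definition signed_label :: "nat \<Rightarrow> 'b rel \<Rightarrow> 'b rel \<Rightarrow> 'b set \<Rightarrow> 'b set \<Rightarrow> int" where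
  "signed_label K r1 r2 A B =
     (if \<exists>F\<in>A. rank_code K r1 r2 A B True F = max_rank K r1 r2 A B
      then int (max_rank K r1 r2 A B) else - int (max_rank K r1 r2 A B))"

text \<open>The families seen from a point and from its antipode; the bounds ensure that the
  \<open>GREATEST\<close> in \<open>longest\<close> is attained.\<close>

locale bounded_signed_pair =
  fixes K :: nat and r1 r2 :: "'b rel" and \<F> A B :: "'b set"
  assumes finite_family: "finite \<F>"
    and subsets: "A \<subseteq> \<F>" "B \<subseteq> \<F>"
    and disjoint: "A \<inter> B = {}"
    and nonempty: "A \<union> B \<noteq> {}"
    and total1: "total_on \<F> r1"
    and total2: "total_on \<F> r2"
    and bound1: "\<forall>s k F. pattern A B (r1 \<inter> r2) s k F \<longrightarrow> k \<le> K"
    and bound2: "\<forall>s k F. pattern A B (r1 \<inter> r2\<inverse>) s k F \<longrightarrow> k \<le> K"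
begin

lemma swap: "bounded_signed_pair K r1 r2 \<F> B A"
proof
  show "\<forall>s k F. pattern B A (r1 \<inter> r2) s k F \<longrightarrow> k \<le> K"
    using bound1 by (simp add: pattern_swap[of B A])
  show "\<forall>s k F. pattern B A (r1 \<inter> r2\<inverse>) s k F \<longrightarrow> k \<le> K"
    using bound2 by (simp add: pattern_swap[of B A])
qed (use finite_family subsets disjoint nonempty total1 total2 in auto)

lemma rank_code_range:
  assumes "F \<in> (if s then A else B)"
  shows "rank_code K r1 r2 A B s F \<in> {1..K\<^sup>2}"
proof -
  let ?a = "longest A B (r1 \<inter> r2) s F" and ?d = "longest A B (r1 \<inter> r2\<inverse>) s F"
  have a: "?a \<in> {1..K}"
    by (rule longest_range[OF bound1 assms])
  have d: "?d \<in> {1..K}"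
    by (rule longest_range[OF bound2 assms])
  have "(?a - 1) * K + ?d \<le> (K - 1) * K + K"
    using a d by (intro add_mono mult_le_mono1) auto
  also have "\<dots> = K\<^sup>2"
    by (cases K) (simp_all add: power2_eq_square)
  finally show ?thesis
    using d by (simp add: rank_code_def)
qed

text \<open>The two sets are distinct and comparable in both orders, so one precedes the other for
  \<open>r1 \<inter> r2\<close> or for \<open>r1 \<inter> r2\<inverse>\<close>. As their signs are
  opposite, the later one ends a longer pattern for that relation. This makes the sign in
  \<open>signed_label\<close> unambiguous.\<close>

lemma rank_code_neq:
  assumes F: "F \<in> A" and G: "G \<in> B"
  shows "rank_code K r1 r2 A B True F \<noteq> rank_code K r1 r2 A B False G"
proof
  let ?a = "\<lambda>s F. longest A B (r1 \<inter> r2) s F" and ?d = "\<lambda>s F. longest A B (r1 \<inter> r2\<inverse>) s F"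
  assume eq: "rank_code K r1 r2 A B True F = rank_code K r1 r2 A B False G"
  have range: "?a True F \<in> {1..K}" "?a False G \<in> {1..K}" "?d True F \<in> {1..K}" "?d False G \<in> {1..K}"
    using longest_range[OF bound1, where s = True and F = F] longest_range[OF bound1, where s = False and F = G]
      longest_range[OF bound2, where s = True and F = F] longest_range[OF bound2, where s = False and F = G] F G
    by simp_all
  \<comment> \<open>The code minus 1 has the base \<open>K\<close> digits \<open>a - 1\<close> and
    \<open>d - 1\<close>, so its quotient by \<open>K\<close> recovers the first length.\<close>
  have div: "((a - 1) * K + d - 1) div K = a - 1" if "a \<in> {1..K}" "d \<in> {1..K}" for a d
  proof -
    have "(a - 1) * K + d - 1 = (d - 1) + (a - 1) * K" "d - 1 < K"
      using that by auto
    then show ?thesis by simp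
  qed
  have "?a True F - 1 = ?a False G - 1"
    using eq div[of "?a True F" "?d True F"] div[of "?a False G" "?d False G"] range
    by (simp add: rank_code_def)
  then have a: "?a True F = ?a False G"
    using range by auto
  then have d: "?d True F = ?d False G"
    using eq by (simp add: rank_code_def)
  have "F \<noteq> G" "F \<in> \<F>" "G \<in> \<F>"
    using F G disjoint subsets by auto
  then have "((F, G) \<in> r1 \<or> (G, F) \<in> r1) \<and> ((F, G) \<in> r2 \<or> (G, F) \<in> r2)"
    using total1 total2 by (auto simp: total_on_def)
  then consider "(F, G) \<in> r1 \<inter> r2" | "(F, G) \<in> r1 \<inter> r2\<inverse>" | "(G, F) \<in> r1 \<inter> r2" | "(G, F) \<in> r1 \<inter> r2\<inverse>"
    by blast
  then show False
  proof cases
    case 1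
    then show False
      using longest_less[OF bound1, where s = False and G = F and F = G] F G a by simp
  next
    case 2
    then show False
      using longest_less[OF bound2, where s = False and G = F and F = G] F G d by simp
  next
    case 3
    then show False
      using longest_less[OF bound1, where s = True and G = G and F = F] F G a by simp
  next
    case 4
    then show False
      using longest_less[OF bound2, where s = True and G = G and F = F] F G d by simp
  qed
qed

lemma rank_code_swap: "rank_code K r1 r2 B A s F = rank_code K r1 r2 A B (\<not> s) F"
  by (simp add: rank_code_def longest_def pattern_swap[of B A])

lemma max_rank_swap: "max_rank K r1 r2 B A = max_rank K r1 r2 A B"
  by (simp add: max_rank_def rank_code_swap Un_commute)

lemma max_rank_in:
  "max_rank K r1 r2 A B \<in> rank_code K r1 r2 A B True ` A \<union> rank_code K r1 r2 A B False ` B"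
  unfolding max_rank_def
  using finite_subset[OF subsets(1) finite_family] finite_subset[OF subsets(2) finite_family] nonempty
  by (intro Max_in) auto

lemma max_rank_ge:
  "F \<in> (if s then A else B) \<Longrightarrow> rank_code K r1 r2 A B s F \<le> max_rank K r1 r2 A B"
  unfolding max_rank_def
  using finite_subset[OF subsets(1) finite_family] finite_subset[OF subsets(2) finite_family]
  by (intro Max_ge) (auto split: if_splits)

lemma max_rank_range: "max_rank K r1 r2 A B \<in> {1..K\<^sup>2}"
  using max_rank_in rank_code_range[of _ True] rank_code_range[of _ False] by auto

lemma signed_label_cases:
  obtains F where "F \<in> A" "rank_code K r1 r2 A B True F = max_rank K r1 r2 A B"
      "signed_label K r1 r2 A B = int (max_rank K r1 r2 A B)"
  | F where "F \<in> B" "rank_code K r1 r2 A B False F = max_rank K r1 r2 A B"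
      "signed_label K r1 r2 A B = - int (max_rank K r1 r2 A B)"
proof (cases "\<exists>F\<in>A. rank_code K r1 r2 A B True F = max_rank K r1 r2 A B")
  case True
  then show thesis
    using that(1) by (auto simp: signed_label_def)
next
  case False
  then obtain F where "F \<in> B" "rank_code K r1 r2 A B False F = max_rank K r1 r2 A B"
    using max_rank_in by force
  then show thesis
    using that(2) False by (simp add: signed_label_def)
qed

lemma signed_label_pos:
  "F \<in> A \<Longrightarrow> rank_code K r1 r2 A B True F = max_rank K r1 r2 A B \<Longrightarrow>
    signed_label K r1 r2 A B = int (max_rank K r1 r2 A B)"
  by (auto simp: signed_label_def)

lemma signed_label_neg:
  "F \<in> B \<Longrightarrow> rank_code K r1 r2 A B False F = max_rank K r1 r2 A B \<Longrightarrow>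
    signed_label K r1 r2 A B = - int (max_rank K r1 r2 A B)"
  using rank_code_neq by (fastforce simp: signed_label_def)

lemma abs_signed_label: "\<bar>signed_label K r1 r2 A B\<bar> = int (max_rank K r1 r2 A B)"
  by (simp add: signed_label_def)

lemma signed_label_swap: "signed_label K r1 r2 B A = - signed_label K r1 r2 A B"
proof -
  interpret swapped: bounded_signed_pair K r1 r2 \<F> B A
    by (rule swap)
  show ?thesis
  proof (cases rule: signed_label_cases)
    case (1 F)
    then show ?thesis
      using swapped.signed_label_neg[of F] by (simp add: rank_code_swap max_rank_swap)
  next
    case (2 F)
    then show ?thesis
      using swapped.signed_label_pos[of F] by (simp add: rank_code_swap max_rank_swap)
  qed
qed

end

lemma rank_code_mono:
  assumes "bounded_signed_pair K r1 r2 \<F> A B" "bounded_signed_pair K r1 r2 \<F> A' B'"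
    and sub: "A \<subseteq> A'" "B \<subseteq> B'" and F: "F \<in> (if s then A else B)"
  shows "rank_code K r1 r2 A B s F \<le> rank_code K r1 r2 A' B' s F"
proof -
  interpret P: bounded_signed_pair K r1 r2 \<F> A B by fact
  interpret Q: bounded_signed_pair K r1 r2 \<F> A' B' by fact
  have F': "F \<in> (if s then A' else B')"
    using F sub by (auto split: if_splits)
  have "longest A B (r1 \<inter> r2) s F \<le> longest A' B' (r1 \<inter> r2) s F"
    by (rule longest_ge[OF Q.bound1 F' pattern_mono[OF pattern_longest[OF P.bound1 F] sub]])
  moreover have "longest A B (r1 \<inter> r2\<inverse>) s F \<le> longest A' B' (r1 \<inter> r2\<inverse>) s F"
    by (rule longest_ge[OF Q.bound2 F' pattern_mono[OF pattern_longest[OF P.bound2 F] sub]])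
  ultimately show ?thesis
    unfolding rank_code_def by (intro add_mono mult_le_mono1 diff_le_mono)
qed

text \<open>A set attaining the maximum in the smaller families has at least this code in the larger
  ones. If the maximum does not grow, the same set attains it there and fixes the same sign.\<close>

lemma signed_label_mono:
  assumes "bounded_signed_pair K r1 r2 \<F> A B" "bounded_signed_pair K r1 r2 \<F> A' B'"
    and sub: "A \<subseteq> A'" "B \<subseteq> B'"
  shows "\<bar>signed_label K r1 r2 A B\<bar> \<le> \<bar>signed_label K r1 r2 A' B'\<bar>"
    and "\<bar>signed_label K r1 r2 A B\<bar> = \<bar>signed_label K r1 r2 A' B'\<bar> \<Longrightarrow>
      signed_label K r1 r2 A B = signed_label K r1 r2 A' B'"
proof -
  interpret P: bounded_signed_pair K r1 r2 \<F> A B by fact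
  interpret Q: bounded_signed_pair K r1 r2 \<F> A' B' by fact
  note mono = rank_code_mono[OF assms]
  have *: "max_rank K r1 r2 A B \<le> max_rank K r1 r2 A' B' \<and>
    (max_rank K r1 r2 A B = max_rank K r1 r2 A' B' \<longrightarrow>
      signed_label K r1 r2 A B = signed_label K r1 r2 A' B')"
  proof (cases rule: P.signed_label_cases)
    case (1 F)
    then show ?thesis
      using mono[of F True] Q.max_rank_ge[of F True] Q.signed_label_pos[of F] sub by fastforce
  next
    case (2 F)
    then show ?thesis
      using mono[of F False] Q.max_rank_ge[of F False] Q.signed_label_neg[of F] sub by fastforce
  qed
  then show "\<bar>signed_label K r1 r2 A B\<bar> \<le> \<bar>signed_label K r1 r2 A' B'\<bar>"
    by (simp add: P.abs_signed_label Q.abs_signed_label)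
  show "signed_label K r1 r2 A B = signed_label K r1 r2 A' B'"
    if "\<bar>signed_label K r1 r2 A B\<bar> = \<bar>signed_label K r1 r2 A' B'\<bar>"
    using * that by (simp add: P.abs_signed_label Q.abs_signed_label)
qed

section \<open>Covers and alternating monotone patterns\<close>

text \<open>\<open>A\<close> and \<open>B\<close> may be proper subfamilies of those at
  \<open>u\<close> and \<open>- u\<close>, because thickened families are only known to be contained
  in the families at some witness.\<close>

definition witnessed :: "'a::real_normed_vector set set \<Rightarrow> 'a set set \<Rightarrow> 'a set set \<Rightarrow> bool" where
  "witnessed \<F> A B \<longleftrightarrow> A \<union> B \<noteq> {} \<and> A \<union> B \<subseteq> \<F> \<and>
     (\<exists>u. norm u = 1 \<and> (\<forall>F\<in>A. u \<in> F) \<and> (\<forall>F\<in>B. - u \<in> F))"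

definition members_near :: "'a::metric_space set set \<Rightarrow> real \<Rightarrow> 'a \<Rightarrow> 'a set set" where
  "members_near \<F> d v = {F \<in> \<F>. \<exists>y\<in>F. dist v y \<le> d}"

lemma members_near_mono: "d + dist v w \<le> e \<Longrightarrow> members_near \<F> d v \<subseteq> members_near \<F> e w"
  unfolding members_near_def by (smt (verit) Collect_mono dist_commute dist_triangle2)

text \<open>A Lebesgue number argument: each \<open>u\<close> has an open neighbourhood whose points
  and antipodes lie in no members beyond those at \<open>u\<close> and \<open>- u\<close>, and
  compactness gives a radius \<open>\<epsilon>\<close> such that every ball centred on the sphere
  fits into one of these neighbourhoods.\<close>

lemma witnessed_members_near:
  fixes \<F> :: "'a::euclidean_space set set"
  assumes "finite \<F>" "\<forall>F\<in>\<F>. closed F" and cover: "sphere 0 1 \<subseteq> \<Union>\<F>"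
  obtains \<epsilon> where "0 < \<epsilon>"
    and "\<And>d v. 0 \<le> d \<Longrightarrow> d < \<epsilon> \<Longrightarrow> norm v = 1 \<Longrightarrow>
      witnessed \<F> (members_near \<F> d v) (members_near \<F> d (- v))"
proof -
  define \<G> where "\<G> = {G. open G \<and>
    (\<exists>u. norm u = 1 \<and> (\<forall>y\<in>G. \<forall>F\<in>\<F>. (y \<in> F \<longrightarrow> u \<in> F) \<and> (- y \<in> F \<longrightarrow> - u \<in> F)))}"
  have cover_G: "sphere (0::'a) 1 \<subseteq> \<Union>\<G>"
  proof
    fix u :: 'a assume u: "u \<in> sphere 0 1"
    define G where "G = - (\<Union>{F \<in> \<F>. u \<notin> F} \<union> \<Union>{uminus ` F |F. F \<in> \<F> \<and> - u \<notin> F})"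
    have "closed (uminus ` F)" if "F \<in> \<F>" for F
      using that assms(2) closed_negations by blast
    then have "open G"
      unfolding G_def using assms(1,2)
      by (intro open_Compl closed_Un closed_Union) (auto simp: setcompr_eq_image)
    moreover have "norm u = 1"
      using u by simp
    moreover have "\<forall>y\<in>G. \<forall>F\<in>\<F>. (y \<in> F \<longrightarrow> u \<in> F) \<and> (- y \<in> F \<longrightarrow> - u \<in> F)"
    proof (intro ballI conjI impI)
      fix y F assume y: "y \<in> G" and F: "F \<in> \<F>"
      show "u \<in> F" if "y \<in> F"
        using that y F unfolding G_def by blast
      show "- u \<in> F" if "- y \<in> F"
      proof (rule ccontr)
        assume "- u \<notin> F"
        moreover have "y \<in> uminus ` F"
          using that by (rule rev_image_eqI) simp
        ultimately show False
          using y F unfolding G_def by blast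
      qed
    qed
    ultimately have "G \<in> \<G>"
      unfolding \<G>_def by blast
    moreover have "u \<in> G"
      by (auto simp: G_def)
    ultimately show "u \<in> \<Union>\<G>" by blast
  qed
  have open_G: "open G" if "G \<in> \<G>" for G
    using that by (simp add: \<G>_def)
  obtain \<epsilon> where "0 < \<epsilon>" and \<epsilon>: "\<And>v. v \<in> sphere 0 1 \<Longrightarrow> \<exists>G\<in>\<G>. ball v \<epsilon> \<subseteq> G"
    using Heine_Borel_lemma[OF compact_sphere cover_G open_G] by blast
  have near: "witnessed \<F> (members_near \<F> d v) (members_near \<F> d (- v))"
    if d: "0 \<le> d" "d < \<epsilon>" and v: "norm v = 1" for d v
  proof -
    obtain G u where G: "ball v \<epsilon> \<subseteq> G" and "norm u = 1"
      and u: "\<And>y F. y \<in> G \<Longrightarrow> F \<in> \<F> \<Longrightarrow> (y \<in> F \<longrightarrow> u \<in> F) \<and> (- y \<in> F \<longrightarrow> - u \<in> F)"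
      using \<epsilon>[of v] v unfolding \<G>_def by auto
    have "u \<in> F" if F: "F \<in> members_near \<F> d v" for F
    proof -
      obtain y where y: "y \<in> F" "dist v y \<le> d" "F \<in> \<F>"
        using F by (auto simp: members_near_def)
      then have "y \<in> G"
        using d by (intro subsetD[OF G]) simp
      then show ?thesis
        using u y by blast
    qed
    moreover have "- u \<in> F" if F: "F \<in> members_near \<F> d (- v)" for F
    proof -
      obtain y where y: "y \<in> F" "dist (- v) y \<le> d" "F \<in> \<F>"
        using F by (auto simp: members_near_def)
      then have "- y \<in> G"
        using d dist_minus[of v "- y"] by (intro subsetD[OF G]) simp
      then show ?thesis
        using u[of "- y" F] y by simp
    qed
    moreover obtain F where "F \<in> \<F>" "v \<in> F"
      using cover v by auto
    then have "F \<in> members_near \<F> d v"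
      using d(1) by (auto simp: members_near_def intro!: bexI[of _ v])
    ultimately show ?thesis
      using \<open>norm u = 1\<close> by (auto simp: witnessed_def members_near_def)
  qed
  show thesis
    using \<open>0 < \<epsilon>\<close> near by (rule that)
qed

text \<open>Otherwise the values would increase strictly from at least 1, and \<open>f m\<close>
  would exceed \<open>m\<close>.\<close>

lemma monotone_bounded_sequence_stalls:
  fixes f :: "nat \<Rightarrow> nat"
  assumes "\<And>r. r < m \<Longrightarrow> f r \<le> f (Suc r)" "f m \<le> m" "1 \<le> f 0"
  shows "\<exists>r<m. f r = f (Suc r)"
proof (rule ccontr)
  assume "\<not> ?thesis"
  then have less: "f r < f (Suc r)" if "r < m" for r
    using assms(1)[OF that] that by fastforce
  have "r < f r" if "r \<le> m" for r
    using that
  proof (induction r)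
    case (Suc r)
    then show ?case
      using less[of r] by simp
  qed (use assms(3) in simp)
  then show False
    using assms(2) by fastforce
qed

text \<open>Each point is labelled at the radii \<open>0, \<delta>, ..., m * \<delta>\<close>, and
  the label at the first radius where it repeats is kept. Families of close points are nested once
  the radius grows by \<open>\<delta>\<close>, so monotonicity excludes opposite labels at close
  points, and \<open>tucker_labelling\<close> applies.\<close>

lemma monotone_label_bound:
  fixes \<F> :: "'a::euclidean_space set set" and L :: "'a set set \<Rightarrow> 'a set set \<Rightarrow> int"
  assumes \<F>: "finite \<F>" "\<forall>F\<in>\<F>. closed F" "sphere 0 1 \<subseteq> \<Union>\<F>"
    and range: "\<And>A B. witnessed \<F> A B \<Longrightarrow> L A B \<noteq> 0 \<and> \<bar>L A B\<bar> \<le> int m"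
    and swap: "\<And>A B. witnessed \<F> A B \<Longrightarrow> L B A = - L A B"
    and mono: "\<And>A B A' B'. witnessed \<F> A B \<Longrightarrow> witnessed \<F> A' B' \<Longrightarrow> A \<subseteq> A' \<Longrightarrow> B \<subseteq> B' \<Longrightarrow>
      \<bar>L A B\<bar> \<le> \<bar>L A' B'\<bar> \<and> (\<bar>L A B\<bar> = \<bar>L A' B'\<bar> \<longrightarrow> L A B = L A' B')"
  shows "DIM('a) \<le> m"
proof -
  obtain \<epsilon> where "0 < \<epsilon>"
    and \<epsilon>: "\<And>d v. 0 \<le> d \<Longrightarrow> d < \<epsilon> \<Longrightarrow> norm v = 1 \<Longrightarrow>
      witnessed \<F> (members_near \<F> d v) (members_near \<F> d (- v))"
    using witnessed_members_near[OF \<F>] by blast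
  \<comment> \<open>Every radius up to \<open>m * \<delta>\<close> must stay below
    \<open>\<epsilon>\<close>.\<close>
  define \<delta> where "\<delta> = \<epsilon> / (real m + 1)"
  have \<delta>: "0 < \<delta>" "real m * \<delta> < \<epsilon>"
    using \<open>0 < \<epsilon>\<close> by (auto simp: \<delta>_def field_simps)
  define N where "N r v = members_near \<F> (real r * \<delta>) v" for r v
  define l where "l r v = L (N r v) (N r (- v))" for r v
  have wit: "witnessed \<F> (N r v) (N r (- v))" if "r \<le> m" "norm v = 1" for r v
  proof -
    have "real r * \<delta> \<le> real m * \<delta>"
      using that(1) \<delta>(1) by (intro mult_right_mono) auto
    then have "real r * \<delta> < \<epsilon>" "0 \<le> real r * \<delta>"
      using \<delta> by (linarith, simp)
    then show ?thesis
      unfolding N_def using that(2) by (intro \<epsilon>)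
  qed
  have l_uminus: "l r (- v) = - l r v" if "r \<le> m" "norm v = 1" for r v
    using swap[OF wit[OF that]] by (simp add: l_def)
  have l_range: "l r v \<noteq> 0 \<and> \<bar>l r v\<bar> \<le> int m" if "r \<le> m" "norm v = 1" for r v
    using range[OF wit[OF that]] by (simp add: l_def)
  have l_mono: "\<bar>l r v\<bar> \<le> \<bar>l s w\<bar> \<and> (\<bar>l r v\<bar> = \<bar>l s w\<bar> \<longrightarrow> l r v = l s w)"
    if "s \<le> m" "norm v = 1" "norm w = 1" "real r * \<delta> + dist v w \<le> real s * \<delta>" for r s v w
  proof -
    have "real r * \<delta> \<le> real s * \<delta>"
      using that(4) zero_le_dist[of v w] by linarith
    then have "r \<le> s"
      using \<delta>(1) by simp
    then show ?thesis
      unfolding l_def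
      using that by (intro mono wit) (auto simp: N_def dist_minus intro!: members_near_mono)
  qed
  have stall: "\<exists>r<m. l r v = l (Suc r) v" if v: "norm v = 1" for v
  proof -
    have step: "\<bar>l r v\<bar> \<le> \<bar>l (Suc r) v\<bar> \<and> (\<bar>l r v\<bar> = \<bar>l (Suc r) v\<bar> \<longrightarrow> l r v = l (Suc r) v)"
      if "r < m" for r
      using that v \<delta>(1) by (intro l_mono) (auto simp: algebra_simps)
    have "\<exists>r<m. nat \<bar>l r v\<bar> = nat \<bar>l (Suc r) v\<bar>"
    proof (rule monotone_bounded_sequence_stalls)
      show "nat \<bar>l r v\<bar> \<le> nat \<bar>l (Suc r) v\<bar>" if "r < m" for r
        using step[OF that] by (intro nat_mono) simp
      show "nat \<bar>l m v\<bar> \<le> m"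
        using l_range[of m v] v by (simp add: nat_le_iff)
      show "1 \<le> nat \<bar>l 0 v\<bar>"
        using l_range[of 0 v] v by auto
    qed
    then obtain r where "r < m" "\<bar>l r v\<bar> = \<bar>l (Suc r) v\<bar>"
      by (auto simp: eq_nat_nat_iff)
    then show ?thesis
      using step[of r] by blast
  qed
  \<comment> \<open>Negating all labels preserves repetitions, so the least such radius is the same
    for antipodal points.\<close>
  define \<rho> where "\<rho> v = (LEAST r. r < m \<and> l r v = l (Suc r) v)" for v
  have \<rho>: "\<rho> v < m" "l (\<rho> v) v = l (Suc (\<rho> v)) v" if "norm v = 1" for v
    using LeastI_ex[OF stall[OF that, unfolded Bex_def]] unfolding \<rho>_def by auto
  have \<rho>_uminus: "\<rho> (- v) = \<rho> v" if "norm v = 1" for v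
    unfolding \<rho>_def using that by (intro arg_cong[where f = Least] ext) (auto simp: l_uminus)
  have compat: "l (\<rho> v) v + l (\<rho> w) w \<noteq> 0"
    if v: "norm v = 1" and w: "norm w = 1" and "dist v w \<le> \<delta>" and "\<rho> v \<le> \<rho> w" for v w
  proof
    assume sum: "l (\<rho> v) v + l (\<rho> w) w = 0"
    \<comment> \<open>The family of \<open>v\<close> at radius \<open>\<rho> v * \<delta>\<close>
      lies in that of \<open>w\<close> one radius after \<open>\<rho> w\<close>, where
      \<open>w\<close> still has the same label; equal absolute values then force equal
      signs.\<close>
    have "real (\<rho> v) * \<delta> \<le> real (\<rho> w) * \<delta>"
      using that(4) \<delta>(1) by (intro mult_right_mono) auto
    then have "real (\<rho> v) * \<delta> + dist v w \<le> real (Suc (\<rho> w)) * \<delta>"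
      using that(3) unfolding of_nat_Suc distrib_right by linarith
    then have "\<bar>l (\<rho> v) v\<bar> = \<bar>l (Suc (\<rho> w)) w\<bar> \<longrightarrow> l (\<rho> v) v = l (Suc (\<rho> w)) w"
      using l_mono[of "Suc (\<rho> w)" v w "\<rho> v"] v w \<rho>[OF w] by simp
    then show False
      using sum \<rho>[OF w] l_range[of "\<rho> w" w] w by auto
  qed
  show ?thesis
  proof (rule tucker_labelling[where lab = "\<lambda>v. l (\<rho> v) v"])
    show "l (\<rho> (- v)) (- v) = - l (\<rho> v) v" if "norm v = 1" for v
      using \<rho>[OF that] that by (simp add: \<rho>_uminus l_uminus)
    show "l (\<rho> v) v \<noteq> 0 \<and> \<bar>l (\<rho> v) v\<bar> \<le> int m" if "norm v = 1" for v
      using \<rho>[OF that] that by (intro l_range) auto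
    show "l (\<rho> v) v + l (\<rho> w) w \<noteq> 0" if "norm v = 1" "norm w = 1" "dist v w \<le> \<delta>" for v w
      using compat[of v w] compat[of w v] that by (cases "\<rho> v \<le> \<rho> w") (auto simp: dist_commute add.commute)
  qed (rule \<delta>(1))
qed

section \<open>The lower bound on the pattern length\<close>

lemma pattern_alternating_at:
  fixes u :: "'a::real_vector"
  assumes "pattern A B R s k F" and A: "\<forall>F\<in>A. u \<in> F" and B: "\<forall>F\<in>B. - u \<in> F"
  obtains f where "alternating_at u k f" "\<forall>i\<in>{1..k}. f i \<in> A \<union> B"
    "\<forall>i\<in>{1..<k}. (f i, f (Suc i)) \<in> R"
proof -
  obtain f where f: "1 \<le> k" "\<forall>i\<in>{1..k}. f i \<in> (if s = even (k - i) then A else B)"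
    "\<forall>i\<in>{1..<k}. (f i, f (Suc i)) \<in> R"
    using pattern_sequence[OF assms(1)] by blast
  have pos: "u \<in> (\<lambda>v. (-1) ^ j *\<^sub>R v) ` F" if "F \<in> (if even j then A else B)" for j F
    using that A B
    by (cases "even j") (auto simp: image_iff intro: bexI[of _ u] bexI[of _ "- u"])
  have "alternating_at u k f"
  \<comment> \<open>This equation says that the first set is taken from \<open>A\<close>, which
    decides between the two forms of alternation.\<close>
  proof (cases "s = even (k - 1)")
    case True
    have "u \<in> (\<lambda>v. (-1) ^ (i - 1) *\<^sub>R v) ` f i" if i: "i \<in> {1..k}" for i
    proof (rule pos)
      have "(s = even (k - i)) = even (i - 1)"
        using i True by auto
      then show "f i \<in> (if even (i - 1) then A else B)"
        using f(2) i by metis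
    qed
    then show ?thesis
      by (simp add: alternating_at_def)
  next
    case False
    have "u \<in> (\<lambda>v. (-1) ^ i *\<^sub>R v) ` f i" if i: "i \<in> {1..k}" for i
    proof (rule pos)
      have "(s = even (k - i)) = even i"
        using i False by auto
      then show "f i \<in> (if even i then A else B)"
        using f(2) i by metis
    qed
    then show ?thesis
      by (simp add: alternating_at_def)
  qed
  moreover have "\<forall>i\<in>{1..k}. f i \<in> A \<union> B"
    using f(2) by (auto split: if_splits)
  ultimately show thesis
    using f(3) that by blast
qed

text \<open>If all patterns were shorter, their lengths would be at most some \<open>K\<close> with
  \<open>K\<^sup>2 < DIM('a)\<close>. Then \<open>signed_label\<close> meets the hypotheses of
  \<open>monotone_label_bound\<close> with \<open>m = K\<^sup>2\<close>, a contradiction.\<close>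

theorem alternating_monotone_pattern:
  fixes \<F> :: "'a::euclidean_space set set"
  assumes \<F>: "finite \<F>" "\<forall>F\<in>\<F>. closed F \<and> antipodal_free F" "sphere 0 1 \<subseteq> \<Union>\<F>"
    and total: "total_on \<F> r1" "total_on \<F> r2"
  shows "\<exists>u\<in>sphere 0 1. \<exists>k f. DIM('a) \<le> k\<^sup>2 \<and> (\<forall>i\<in>{1..k}. f i \<in> \<F>) \<and>
    alternating_at u k f \<and> monotone_seq r1 k f \<and> monotone_seq r2 k f"
proof (rule ccontr)
  assume neg: "\<not> ?thesis"
  \<comment> \<open>The largest integer whose square is below \<open>DIM('a)\<close>.\<close>
  define K where "K = nat \<lfloor>sqrt (real (DIM('a) - 1))\<rfloor>"
  have "real K \<le> sqrt (real (DIM('a) - 1))"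
    by (simp add: K_def)
  then have "(real K)\<^sup>2 \<le> real (DIM('a) - 1)"
    by (metis of_nat_0_le_iff real_le_rsqrt real_sqrt_le_iff real_sqrt_pow2 power_mono)
  then have K: "K\<^sup>2 < DIM('a)"
    using DIM_positive[where 'a = 'a] by (metis of_nat_le_iff of_nat_power le_imp_less_Suc Suc_pred')
  have bound: "k \<le> K" if wit: "witnessed \<F> A B" and P: "pattern A B R s k F"
    and R: "R = r1 \<inter> r2 \<or> R = r1 \<inter> r2\<inverse>" for A B R s k F
  proof -
    obtain u where u: "norm u = 1" "\<forall>F\<in>A. u \<in> F" "\<forall>F\<in>B. - u \<in> F" and sub: "A \<union> B \<subseteq> \<F>"
      using wit by (auto simp: witnessed_def)
    obtain f where f: "alternating_at u k f" "\<forall>i\<in>{1..k}. f i \<in> A \<union> B"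
      "\<forall>i\<in>{1..<k}. (f i, f (Suc i)) \<in> R"
      using pattern_alternating_at[OF P u(2,3)] .
    have "monotone_seq r1 k f" "monotone_seq r2 k f"
      using f(3) R by (auto simp: monotone_seq_def)
    moreover have "\<forall>i\<in>{1..k}. f i \<in> \<F>"
      using f(2) sub by blast
    moreover have "u \<in> sphere 0 1"
      using u(1) by simp
    ultimately have "\<not> DIM('a) \<le> k\<^sup>2"
      using neg f(1) by blast
    then have "real (k\<^sup>2) \<le> real (DIM('a) - 1)"
      by (simp add: not_le flip: of_nat_power)
    then have "real k \<le> sqrt (real (DIM('a) - 1))"
      by (intro real_le_rsqrt) simp
    then show ?thesis
      unfolding K_def by (rule le_nat_floor)
  qed
  have pair: "bounded_signed_pair K r1 r2 \<F> A B" if wit: "witnessed \<F> A B" for A B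
  proof
    show "A \<inter> B = {}"
    proof (rule ccontr)
      assume "A \<inter> B \<noteq> {}"
      then obtain F u where "F \<in> \<F>" "u \<in> F" "- u \<in> F"
        using wit unfolding witnessed_def by blast
      then have "u \<in> F \<inter> uminus ` F"
        by (auto simp: image_iff intro: bexI[of _ "- u"])
      then show False
        using \<open>F \<in> \<F>\<close> \<F>(2) unfolding antipodal_free_def by blast
    qed
    show "\<forall>s k F. pattern A B (r1 \<inter> r2) s k F \<longrightarrow> k \<le> K"
      "\<forall>s k F. pattern A B (r1 \<inter> r2\<inverse>) s k F \<longrightarrow> k \<le> K"
      using bound[OF wit] by blast+
  qed (use wit \<F>(1) total in \<open>auto simp: witnessed_def\<close>)
  have "DIM('a) \<le> K\<^sup>2"
  proof (rule monotone_label_bound[where \<F> = \<F> and L = "signed_label K r1 r2"])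
    fix A B assume wit: "witnessed \<F> A B"
    interpret bounded_signed_pair K r1 r2 \<F> A B
      by (rule pair[OF wit])
    have "max_rank K r1 r2 A B \<in> {1..K\<^sup>2}" "\<bar>signed_label K r1 r2 A B\<bar> = int (max_rank K r1 r2 A B)"
      by (rule max_rank_range abs_signed_label)+
    then show "signed_label K r1 r2 A B \<noteq> 0 \<and> \<bar>signed_label K r1 r2 A B\<bar> \<le> int (K\<^sup>2)"
      by (simp only: of_nat_le_iff) auto
    show "signed_label K r1 r2 B A = - signed_label K r1 r2 A B"
      by (rule signed_label_swap)
  next
    fix A B A' B'
    assume "witnessed \<F> A B" "witnessed \<F> A' B'" "A \<subseteq> A'" "B \<subseteq> B'"
    then show "\<bar>signed_label K r1 r2 A B\<bar> \<le> \<bar>signed_label K r1 r2 A' B'\<bar> \<and>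
      (\<bar>signed_label K r1 r2 A B\<bar> = \<bar>signed_label K r1 r2 A' B'\<bar> \<longrightarrow>
        signed_label K r1 r2 A B = signed_label K r1 r2 A' B')"
      using signed_label_mono[OF pair pair, of A B A' B'] by blast
  qed (use \<F> in auto)
  then show False
    using K by simp
qed

section \<open>A small cover\<close>

text \<open>The threshold is half of \<open>1 / CARD('d)\<close>: a unit vector and its antipode
  cannot both lie in the first set, since all coordinates would be so small that the norm is at most
  1/2.\<close>

definition coordinate_cover :: "(real ^ 'd) set set" where
  "coordinate_cover = insert {x \<in> sphere 0 1. \<forall>i. x $ i \<le> 1 / (2 * CARD('d))}
     (range (\<lambda>i. {x \<in> sphere 0 1. 1 / (2 * CARD('d)) \<le> x $ i}))"

lemma sphere_cover_coordinate_cover: "sphere_cover (coordinate_cover :: (real ^ 'd) set set)"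
proof -
  define c :: real where "c = 1 / (2 * CARD('d))"
  define S where "S = (sphere 0 1 :: (real ^ 'd) set)"
  define G where "G = {x \<in> S. \<forall>i. x $ i \<le> c}"
  define H where "H i = {x \<in> S. c \<le> x $ i}" for i
  have c: "0 < c"
    by (simp add: c_def)
  have sphere_closed: "closed {x :: real ^ 'd. norm x = 1}"
    using closed_sphere[of "0 :: real ^ 'd" 1] by (simp add: sphere_def)
  have eq: "(coordinate_cover :: (real ^ 'd) set set) = insert G (range H)"
    by (simp add: coordinate_cover_def G_def H_def[abs_def] S_def c_def)
  have "closed G"
    unfolding G_def S_def Collect_conj_eq
    by (intro closed_Int closed_Collect_all closed_Collect_le continuous_intros) (simp_all add: sphere_closed)
  moreover have "closed (H i)" for i
    unfolding H_def S_def Collect_conj_eq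
    by (intro closed_Int closed_Collect_le continuous_intros) (simp_all add: sphere_closed)
  moreover have "antipodal_free G"
  proof -
    have False if "x \<in> S" "\<forall>i. x $ i \<le> c" "\<forall>i. - x $ i \<le> c" for x
    proof -
      have "\<bar>x $ i\<bar> \<le> c" for i
        using spec[OF that(2), of i] spec[OF that(3), of i] by simp
      then have "norm x \<le> (\<Sum>i\<in>(UNIV :: 'd set). c)"
        using norm_le_l1_cart[of x] by (meson order_trans sum_mono)
      then show False
        using that(1) by (simp add: S_def c_def)
    qed
    then show ?thesis
      unfolding antipodal_free_def G_def by auto
  qed
  moreover have "antipodal_free (H i)" for i
    using c unfolding antipodal_free_def H_def by auto
  moreover have "\<Union>(insert G (range H)) = S"
    unfolding G_def H_def by (auto simp: not_le intro: less_imp_le)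
  moreover have "F \<subseteq> S" if "F \<in> insert G (range H)" for F
    using that by (auto simp: G_def H_def)
  ultimately show ?thesis
    unfolding sphere_cover_def eq S_def[symmetric] by auto
qed

lemma card_coordinate_cover: "card (coordinate_cover :: (real ^ 'd) set set) \<le> CARD('d) + 1"
proof -
  have "card (coordinate_cover :: (real ^ 'd) set set) \<le>
      Suc (card (range (\<lambda>i::'d. {x \<in> sphere 0 1. 1 / (2 * CARD('d)) \<le> x $ i})))"
    unfolding coordinate_cover_def by (rule card_insert_le_m1) auto
  also have "\<dots> \<le> CARD('d) + 1"
    using card_image_le[of "UNIV :: 'd set"] by simp
  finally show ?thesis .
qed

section \<open>Two orders without long common monotone sequences\<close>

lemma linear_order_on_inj_key:
  fixes key :: "'b \<Rightarrow> 'c::linorder"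
  assumes "inj_on key S"
  shows "linear_order_on S {(x, y) \<in> S \<times> S. key x \<le> key y}"
  using assms
  by (auto simp: linear_order_on_def partial_order_on_def preorder_on_def refl_on_def trans_def
      antisym_def total_on_def inj_on_def)

lemma monotone_seq_key:
  fixes key :: "'b \<Rightarrow> 'c::linorder"
  assumes mono: "monotone_seq {(x, y) \<in> S \<times> S. key x \<le> key y} k F"
    and neq: "\<forall>i\<in>{1..<k}. key (F i) \<noteq> key (F (Suc i))"
  shows "(\<forall>i\<in>{1..<k}. key (F i) < key (F (Suc i))) \<or> (\<forall>i\<in>{1..<k}. key (F (Suc i)) < key (F i))"
  using mono unfolding monotone_seq_def
proof (elim disjE)
  assume "\<forall>i\<in>{1..<k}. (F i, F (Suc i)) \<in> {(x, y) \<in> S \<times> S. key x \<le> key y}"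
  then have "\<forall>i\<in>{1..<k}. key (F i) < key (F (Suc i))"
    using neq by (simp add: order_less_le)
  then show ?thesis ..
next
  assume "\<forall>i\<in>{1..<k}. (F (Suc i), F i) \<in> {(x, y) \<in> S \<times> S. key x \<le> key y}"
  then have "\<forall>i\<in>{1..<k}. key (F (Suc i)) < key (F i)"
    using neq by (metis (no_types, lifting) case_prodD mem_Collect_eq order_less_le)
  then show ?thesis ..
qed

lemma strictly_increasing_length:
  fixes h :: "nat \<Rightarrow> nat"
  assumes "\<forall>i\<in>{1..<k}. h i < h (Suc i)" "\<forall>i\<in>{1..k}. h i < s"
  shows "k \<le> s"
proof -
  have "i \<le> Suc (h i)" if "i \<in> {1..k}" for i
    using that
  proof (induction i)
    case (Suc i)
    show ?case
    proof (cases "i = 0")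
      case False
      then have "h i < h (Suc i)"
        using assms(1) Suc.prems by simp
      then show ?thesis
        using Suc False by simp
    qed simp
  qed simp
  from this[of k] show ?thesis
    using assms(2) by (cases "k = 0") (auto dest: bspec[of _ _ k])
qed

lemma strictly_decreasing_length:
  fixes h :: "nat \<Rightarrow> nat"
  assumes "\<forall>i\<in>{1..<k}. h (Suc i) < h i" "\<forall>i\<in>{1..k}. h i < s"
  shows "k \<le> s"
proof (rule strictly_increasing_length[where h = "\<lambda>i. s - Suc (h i)"])
  show "\<forall>i\<in>{1..<k}. s - Suc (h i) < s - Suc (h (Suc i))"
  proof
    fix i assume "i \<in> {1..<k}"
    then have "h (Suc i) < h i" "h i < s"
      using assms by auto
    then show "s - Suc (h i) < s - Suc (h (Suc i))"
      by linarith
  qed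
  show "\<forall>i\<in>{1..k}. s - Suc (h i) < s"
    using assms(2) by auto
qed

text \<open>
  On \<open>{..<s\<^sup>2}\<close>, cut into \<open>s\<close> blocks of length \<open>s\<close>, this key reverses each block and preserves the
  order of the blocks.
\<close>

definition block_key :: "nat \<Rightarrow> nat \<Rightarrow> int" where
  "block_key s i = int (i div s) * int s - int (i mod s)"

text \<open>Inside a block the key reverses the order, so it can increase only by passing to a later
  block.\<close>

lemma block_key_less_imp_div_less:
  assumes "i < j" "block_key s i < block_key s j"
  shows "i div s < j div s"
proof (rule ccontr)
  assume "\<not> i div s < j div s"
  moreover have "i div s \<le> j div s"
    using assms(1) by (simp add: div_le_mono)
  ultimately have "i div s = j div s" by simp
  moreover from this have "i mod s < j mod s"
    using assms(1) by (metis add_less_cancel_left div_mult_mod_eq)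
  ultimately show False
    using assms(2) by (simp add: block_key_def)
qed

text \<open>Passing to a later block raises the key, since remainders are below \<open>s\<close>. A
  decrease therefore stays inside one block, where the remainder grows.\<close>

lemma block_key_greater_imp_mod_less:
  assumes "i < j" "block_key s j < block_key s i" "0 < s"
  shows "i mod s < j mod s"
proof -
  have "i div s = j div s"
  proof (rule ccontr)
    assume "i div s \<noteq> j div s"
    then have "Suc (i div s) \<le> j div s"
      using assms(1) by (simp add: div_le_mono Suc_leI le_neq_implies_less)
    then have "(int (i div s) + 1) * int s \<le> int (j div s) * int s"
      by (intro mult_right_mono) auto
    moreover have "int (j mod s) < int s"
      using assms(3) by simp
    ultimately show False
      using assms(2) unfolding block_key_def by (simp add: algebra_simps)
  qed
  then show ?thesis
    using assms(1) by (metis add_less_cancel_left div_mult_mod_eq)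
qed

lemma inj_block_key:
  assumes "0 < s"
  shows "inj (block_key s)"
proof -
  have "block_key s i \<noteq> block_key s j" if "i < j" for i j
  proof
    assume eq: "block_key s i = block_key s j"
    show False
    proof (cases "i div s = j div s")
      case True
      then have "i mod s < j mod s"
        using that by (metis add_less_cancel_left div_mult_mod_eq)
      then show False
        using True eq by (simp add: block_key_def)
    next
      case False
      then have "Suc (i div s) \<le> j div s"
        using that by (simp add: div_le_mono Suc_leI le_neq_implies_less)
      then have "(int (i div s) + 1) * int s \<le> int (j div s) * int s"
        by (intro mult_right_mono) auto
      moreover have "int (j mod s) < int s"
        using assms by simp
      ultimately show False
        using eq unfolding block_key_def by (simp add: algebra_simps)
    qed
  qed
  then show ?thesis
    by (metis injI linorder_neqE_nat)
qed

text \<open>Consecutive sets carry opposite signs, so equality would put an antipodal pair into one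
  set. This makes monotone patterns strictly monotone.\<close>

lemma alternating_at_neq:
  fixes F :: "nat \<Rightarrow> 'a::real_vector set"
  assumes "alternating_at u k F" "i \<in> {1..<k}" "antipodal_free (F i)"
  shows "F i \<noteq> F (Suc i)"
proof
  assume eq: "F i = F (Suc i)"
  obtain j where "u \<in> (\<lambda>v. (-1) ^ j *\<^sub>R v) ` F i" "u \<in> (\<lambda>v. (-1) ^ Suc j *\<^sub>R v) ` F (Suc i)"
  proof -
    have "i \<in> {1..k}" "Suc i \<in> {1..k}" "Suc i - 1 = Suc (i - 1)"
      using assms(2) by auto
    then show thesis
      using assms(1) that[of "i - 1"] that[of i] unfolding alternating_at_def by metis
  qed
  then obtain v w where "u = (-1) ^ j *\<^sub>R v" "u = (-1) ^ Suc j *\<^sub>R w" "v \<in> F i" "w \<in> F i"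
    unfolding eq by blast
  then have "v = - w"
    by (cases "even j") auto
  with \<open>v \<in> F i\<close> \<open>w \<in> F i\<close> show False
    using assms(3) unfolding antipodal_free_def by auto
qed

text \<open>Along a pattern both keys are strictly monotone. In the same direction this makes the
  block number strictly monotone, in opposite directions the remainder; both take values below
  \<open>s\<close>.\<close>

theorem short_alternating_monotone_patterns:
  fixes \<F> :: "'a::real_vector set set"
  assumes "finite \<F>" "\<forall>F\<in>\<F>. antipodal_free F" "card \<F> \<le> s\<^sup>2" "0 < s"
  obtains r1 r2 where "linear_order_on \<F> r1" "linear_order_on \<F> r2"
    and "\<And>u k F. \<forall>i\<in>{1..k}. F i \<in> \<F> \<Longrightarrow> alternating_at u k F \<Longrightarrow>
      monotone_seq r1 k F \<Longrightarrow> monotone_seq r2 k F \<Longrightarrow> k \<le> s"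
proof -
  obtain e where e: "bij_betw e \<F> {0..<card \<F>}"
    using ex_bij_betw_finite_nat[OF assms(1)] by blast
  define r1 where "r1 = {(F, G) \<in> \<F> \<times> \<F>. e F \<le> e G}"
  define r2 where "r2 = {(F, G) \<in> \<F> \<times> \<F>. block_key s (e F) \<le> block_key s (e G)}"
  have inj: "inj_on e \<F>" "inj_on (\<lambda>F. block_key s (e F)) \<F>"
    using e inj_block_key[OF assms(4)]
    by (auto simp: bij_betw_def comp_inj_on[unfolded comp_def] intro: comp_inj_on[unfolded comp_def] inj_on_subset)
  have length: "k \<le> s"
    if F: "\<forall>i\<in>{1..k}. F i \<in> \<F>" and alt: "alternating_at u k F"
      and mono: "monotone_seq r1 k F" "monotone_seq r2 k F" for u k F
  proof -
    define h where "h i = e (F i)" for i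
    define b where "b i = block_key s (h i)" for i
    have neq: "h i \<noteq> h (Suc i)" "b i \<noteq> b (Suc i)" if i: "i \<in> {1..<k}" for i
    proof -
      have "F i \<in> \<F>" "F (Suc i) \<in> \<F>" "F i \<noteq> F (Suc i)"
        using i F alternating_at_neq[OF alt i] assms(2) by auto
      then show "h i \<noteq> h (Suc i)" "b i \<noteq> b (Suc i)"
        using inj by (auto simp: h_def b_def inj_on_def)
    qed
    have "h i < s * s" if "i \<in> {1..k}" for i
      using that F e assms(3) unfolding h_def bij_betw_def power2_eq_square
      by (metis atLeastLessThan_iff imageI order_less_le_trans)
    then have div: "\<forall>i\<in>{1..k}. h i div s < s"
      by (simp add: less_mult_imp_div_less)
    have mod: "\<forall>i\<in>{1..k}. h i mod s < s"
      using assms(4) by simp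
    have "(\<forall>i\<in>{1..<k}. h i < h (Suc i)) \<or> (\<forall>i\<in>{1..<k}. h (Suc i) < h i)"
      unfolding h_def by (rule monotone_seq_key[OF mono(1)[unfolded r1_def]]) (use neq(1) in \<open>simp add: h_def\<close>)
    moreover have "(\<forall>i\<in>{1..<k}. b i < b (Suc i)) \<or> (\<forall>i\<in>{1..<k}. b (Suc i) < b i)"
      unfolding b_def h_def by (rule monotone_seq_key[OF mono(2)[unfolded r2_def]])
        (use neq(2) in \<open>simp add: b_def h_def\<close>)
    ultimately consider
        "\<forall>i\<in>{1..<k}. h i < h (Suc i)" "\<forall>i\<in>{1..<k}. b i < b (Suc i)"
      | "\<forall>i\<in>{1..<k}. h i < h (Suc i)" "\<forall>i\<in>{1..<k}. b (Suc i) < b i"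
      | "\<forall>i\<in>{1..<k}. h (Suc i) < h i" "\<forall>i\<in>{1..<k}. b i < b (Suc i)"
      | "\<forall>i\<in>{1..<k}. h (Suc i) < h i" "\<forall>i\<in>{1..<k}. b (Suc i) < b i"
      by blast
    then show ?thesis
    proof cases
      case 1
      then show ?thesis
        by (intro strictly_increasing_length[OF _ div])
          (auto simp: b_def intro!: block_key_less_imp_div_less)
    next
      case 2
      then show ?thesis
        using assms(4) by (intro strictly_increasing_length[OF _ mod])
          (auto simp: b_def intro!: block_key_greater_imp_mod_less)
    next
      case 3
      then show ?thesis
        using assms(4) by (intro strictly_decreasing_length[OF _ mod])
          (auto simp: b_def intro!: block_key_greater_imp_mod_less)
    next
      case 4
      then show ?thesis
        by (intro strictly_decreasing_length[OF _ div])
          (auto simp: b_def intro!: block_key_less_imp_div_less)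
    qed
  qed
  show thesis
  proof (rule that[of r1 r2])
    show "linear_order_on \<F> r1" "linear_order_on \<F> r2"
      unfolding r1_def r2_def by (intro linear_order_on_inj_key inj)+
  qed (rule length)
qed

theorem theorem2:
  fixes n :: nat
  assumes "CARD('d::finite) = n + 1"
  shows
    "(\<forall>(\<F> :: (real ^ 'd) set set) r1 r2.
        sphere_cover \<F> \<and> linear_order_on \<F> r1 \<and> linear_order_on \<F> r2 \<longrightarrow>
        (\<exists>u\<in>sphere 0 1. \<exists>(k :: nat) F.
           real k \<ge> sqrt ((real n + 1) / 2) \<and>
           (\<forall>i\<in>{1..k}. F i \<in> \<F>) \<and>
           alternating_at u k F \<and> monotone_seq r1 k F \<and> monotone_seq r2 k F))
     \<and>
     (\<exists>(\<F> :: (real ^ 'd) set set) r1 r2.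
        sphere_cover \<F> \<and> linear_order_on \<F> r1 \<and> linear_order_on \<F> r2 \<and>
        (\<forall>u\<in>sphere 0 1. \<forall>k\<ge>1. \<forall>F.
           (\<forall>i\<in>{1..k}. F i \<in> \<F>) \<and>
           alternating_at u k F \<and> monotone_seq r1 k F \<and> monotone_seq r2 k F \<longrightarrow>
           int k \<le> \<lceil>sqrt (real n + 2)\<rceil>))"
proof (intro conjI allI impI)
  fix \<F> :: "(real ^ 'd) set set" and r1 r2
  assume *: "sphere_cover \<F> \<and> linear_order_on \<F> r1 \<and> linear_order_on \<F> r2"
  then have "\<exists>u\<in>sphere 0 1. \<exists>k f. DIM(real ^ 'd) \<le> k\<^sup>2 \<and> (\<forall>i\<in>{1..k}. f i \<in> \<F>) \<and>
      alternating_at u k f \<and> monotone_seq r1 k f \<and> monotone_seq r2 k f"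
    by (intro alternating_monotone_pattern) (auto simp: sphere_cover_def linear_order_on_def)
  \<comment> \<open>The bound obtained is \<open>n + 1 \<le> k\<^sup>2\<close>, stronger than
    required by a factor of 2.\<close>
  moreover have "sqrt ((real n + 1) / 2) \<le> real k" if "DIM(real ^ 'd) \<le> k\<^sup>2" for k
  proof (rule real_le_lsqrt)
    have "real (n + 1) \<le> real (k\<^sup>2)"
      using that assms by (simp only: of_nat_le_iff) simp
    then show "(real n + 1) / 2 \<le> (real k)\<^sup>2"
      by simp
  qed simp
  ultimately show "\<exists>u\<in>sphere 0 1. \<exists>(k :: nat) F.
      sqrt ((real n + 1) / 2) \<le> real k \<and> (\<forall>i\<in>{1..k}. F i \<in> \<F>) \<and>
      alternating_at u k F \<and> monotone_seq r1 k F \<and> monotone_seq r2 k F"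
    by blast
next
  let ?\<F> = "coordinate_cover :: (real ^ 'd) set set"
  \<comment> \<open>With this \<open>s\<close>, the at most \<open>n + 2\<close> sets of the cover
    fit into \<open>s\<close> blocks of length \<open>s\<close>.\<close>
  define s where "s = nat \<lceil>sqrt (real n + 2)\<rceil>"
  have cover: "sphere_cover ?\<F>"
    by (rule sphere_cover_coordinate_cover)
  have "0 < sqrt (real n + 2)"
    by simp
  then have s: "0 < s" "sqrt (real n + 2) \<le> real s" "int s = \<lceil>sqrt (real n + 2)\<rceil>"
    unfolding s_def by (simp add: zero_less_ceiling, simp add: real_nat_ceiling_ge, linarith)
  have "real n + 2 \<le> (real s)\<^sup>2"
    by (rule sqrt_le_D[OF s(2)])
  then have "real (n + 2) \<le> real (s\<^sup>2)"
    by simp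
  then have "n + 2 \<le> s\<^sup>2"
    by (simp only: of_nat_le_iff)
  then have "card ?\<F> \<le> s\<^sup>2"
    using card_coordinate_cover[where 'd = 'd] assms by linarith
  then obtain r1 r2 where "linear_order_on ?\<F> r1" "linear_order_on ?\<F> r2"
    and short: "\<And>u k F. \<forall>i\<in>{1..k}. F i \<in> ?\<F> \<Longrightarrow> alternating_at u k F \<Longrightarrow>
      monotone_seq r1 k F \<Longrightarrow> monotone_seq r2 k F \<Longrightarrow> k \<le> s"
    using short_alternating_monotone_patterns[of ?\<F> s] cover s(1)
    by (auto simp: sphere_cover_def)
  then show "\<exists>(\<F> :: (real ^ 'd) set set) r1 r2.
      sphere_cover \<F> \<and> linear_order_on \<F> r1 \<and> linear_order_on \<F> r2 \<and>
      (\<forall>u\<in>sphere 0 1. \<forall>k\<ge>1. \<forall>F. (\<forall>i\<in>{1..k}. F i \<in> \<F>) \<and> alternating_at u k F \<and>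
        monotone_seq r1 k F \<and> monotone_seq r2 k F \<longrightarrow> int k \<le> \<lceil>sqrt (real n + 2)\<rceil>)"
    using cover unfolding s(3)[symmetric] of_nat_le_iff by blast
qed

end
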